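(* Let $f:\mathbb R\to\mathbb R$ be given by $f(s)=\frac{1}{|s|^3}e^{s^2}$ if $|s|>\beta$ and $f(s)=\alpha s^2$ if $|s|\le\beta$, where $\alpha=\frac{e^{5/2}}{(5/2)^{5/2}}$ and $\beta=\sqrt{5/2}$. There exist a constant $\rho>0$ and a function $\widetilde u\in C^2(B_\rho\setminus\{0\})\cap C(\overline{B}_\rho\setminus\{0\})$ which is a classical solution on $B_\rho\setminus\{0\}$ of the Dirichlet boundary value problem $$-\Delta u=f(u)\ \text{ in }B_\rho,\qquad u=0\ \text{ on }\partial B_\rho.$$ Moreover, the following hold: (i) $\widetilde u(x)=\sqrt{-2\log|x|}$ in a neighborhood of the origin (excluding the origin itself); (ii) $\widetilde u$ is a solution of the elliptic equation $-\Delta u=f(u)$ on $B_\rho$ in the sense of distributions.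
   Context: $B_\rho\subset\mathbb R^2$ denotes the open ball of radius $\rho$ centered at the origin. Being a classical solution on $B_\rho\setminus\{0\}$ of the boundary value problem means that the equation holds pointwise on $B_\rho\setminus\{0\}$ and the boundary condition holds on $\partial B_\rho$. *)

theory Defs
  imports "HOL-Analysis.Analysis"
begin

definition partial_deriv :: "'a::euclidean_space \<Rightarrow> ('a \<Rightarrow> real) \<Rightarrow> 'a \<Rightarrow> real" where
  "partial_deriv i u x = deriv (\<lambda>t. u (x + t *\<^sub>R i)) 0"

definition laplacian :: "('a::euclidean_space \<Rightarrow> real) \<Rightarrow> 'a \<Rightarrow> real" where
  "laplacian u x = (\<Sum>i\<in>Basis. partial_deriv i (partial_deriv i u) x)"

text \<open>The class \<open>C^k(S)\<close>, meant for open \<open>S\<close>: all partial derivatives of order at most \<open>k\<close>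
  exist and are continuous on \<open>S\<close>. The existence requirement is stated separately because
  \<^const>\<open>deriv\<close> is total.\<close>

primrec Ck_on :: "nat \<Rightarrow> ('a::euclidean_space \<Rightarrow> real) \<Rightarrow> 'a set \<Rightarrow> bool" where
  "Ck_on 0 u S \<longleftrightarrow> continuous_on S u"
| "Ck_on (Suc k) u S \<longleftrightarrow> continuous_on S u \<and>
     (\<forall>i\<in>Basis. (\<forall>x\<in>S. (\<lambda>t. u (x + t *\<^sub>R i)) differentiable at 0) \<and>
        Ck_on k (partial_deriv i u) S)"

definition test_function_on :: "'a::euclidean_space set \<Rightarrow> ('a \<Rightarrow> real) \<Rightarrow> bool" where
  "test_function_on S \<phi> \<longleftrightarrow> (\<forall>k. Ck_on k \<phi> UNIV) \<and>
     compact (closure {x. \<phi> x \<noteq> 0}) \<and> closure {x. \<phi> x \<noteq> 0} \<subseteq> S"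

definition locally_integrable_on :: "('a::euclidean_space \<Rightarrow> real) \<Rightarrow> 'a set \<Rightarrow> bool" where
  "locally_integrable_on g S \<longleftrightarrow>
     (\<forall>K. compact K \<and> K \<subseteq> S \<longrightarrow> set_integrable lebesgue K g)"

text \<open>Distributional solutions of \<open>-\<Delta>u = f(u)\<close> on an open set \<open>S\<close>. Local integrability of
  \<open>u\<close> and \<open>f(u)\<close> is what makes both sides distributions on \<open>S\<close>; in particular, all integrals
  below are those of Lebesgue integrable functions.\<close>

definition distributional_solution_on ::
    "(real \<Rightarrow> real) \<Rightarrow> 'a::euclidean_space set \<Rightarrow> ('a \<Rightarrow> real) \<Rightarrow> bool" where
  "distributional_solution_on f S u \<longleftrightarrow>
     locally_integrable_on u S \<and> locally_integrable_on (\<lambda>x. f (u x)) S \<and>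
     (\<forall>\<phi>. test_function_on S \<phi> \<longrightarrow>
        - (LINT x:S|lebesgue. u x * laplacian \<phi> x) = (LINT x:S|lebesgue. f (u x) * \<phi> x))"

definition alpha :: real where
  "alpha = exp (5/2) / (5/2) powr (5/2)"

definition beta :: real where
  "beta = sqrt (5/2)"

definition nonlinearity :: "real \<Rightarrow> real" where
  "nonlinearity s = (if \<bar>s\<bar> > beta then 1 / \<bar>s\<bar> ^ 3 * exp (s\<^sup>2) else alpha * s\<^sup>2)"

end

theory Submission
  imports Defs
begin

text \<open>
  For a radial function $u(x) = g(s)$ with $s = |x|^2$ in the plane, $\Delta u = 4 (s g')'$, so the
  equation is the first-order system $g' = p / s$, $p' = - f(g) / 4$. On $0 < s \le e^{-5/2}$ the
  function $g(s) = \sqrt{- \log s}$ solves it: this is $\sqrt{-2 \log |x|}$, it satisfies $g \ge \beta$,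
  and there $f(g) = 1 / (s g^3)$. The solution is continued to the right of $e^{-5/2}$ with the
  Picard--Lindelof theorem; it decreases at least as fast as a negative multiple of $\log s$, so it
  reaches zero at some $s_0$, and $\rho = \sqrt{s_0}$. Since $f$ is continuous, the two pieces fit
  together to second order.

  In the sense of distributions the singularity at the origin leaves no trace. The truncations
  $v_N = N k(u / N)$, where $k$ is a concave $C^2$ function with $k(0) = 0$, $k'(0) = 1$ that is
  constant on $[1, \infty)$, are constant near the origin, hence $C^2$ on the whole ball, and
  Green's identity applies to them. By the chain rule
  $-\Delta v_N = k'(u/N) f(u) - k''(u/N) |\nabla u|^2 / N$, and the singular part of $u$ satisfies the
  identity $|\nabla u|^2 = u f(u)$. So the error term is $-(z k''(z)) f(u)$ at $z = u / N$: it is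
  dominated by $f(u)$ uniformly in $N$ and tends to zero pointwise. As $f(u)$ is integrable
  (\<open>integrable_log_singularity\<close>), dominated convergence transfers Green's identity from
  $v_N$ to $u$ (\<open>distributional_solution_by_approximation\<close>).
\<close>

section \<open>Picard iteration\<close>

text \<open>The integral equation is solved by Banach's fixed point theorem on the whole interval at once: in
  the supremum norm weighted by \<open>exp (- 2 * L * (t - a))\<close> the integral operator halves distances,
  however long the interval. Bounded continuous functions live on the whole line, so the operator
  evaluates its result at the projection of \<open>t\<close> to \<open>{a..b}\<close>.\<close>

lemma picard_lindelof_global:
  fixes F :: "real \<Rightarrow> 'a::banach \<Rightarrow> 'a"
  assumes ab: "a \<le> b"
    and cont: "continuous_on ({a..b} \<times> UNIV) (\<lambda>(t, y). F t y)"
    and lip: "\<And>t y z. t \<in> {a..b} \<Longrightarrow> norm (F t y - F t z) \<le> L * norm (y - z)"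
    and L: "L > 0"
  obtains y where "y a = y0"
    and "\<And>t. t \<in> {a..b} \<Longrightarrow> (y has_vector_derivative F t (y t)) (at t within {a..b})"
proof -
  define c where "c t = max a (min b t)" for t
  define e where "e t = exp (2 * L * (t - a))" for t
  define J where "J w t = y0 + integral {a..t} (\<lambda>s. F s (e s *\<^sub>R w s))" for w :: "real \<Rightarrow> 'a" and t
  have c_in: "c t \<in> {a..b}" for t using ab by (auto simp: c_def)
  have c_id: "c t = t" if "t \<in> {a..b}" for t using that by (auto simp: c_def)
  have e_pos: "e t > 0" for t by (simp add: e_def)
  have e_cont: "continuous_on S e" for S unfolding e_def by (intro continuous_intros)
  have integrand: "continuous_on {a..t} (\<lambda>s. F s (e s *\<^sub>R w s))"
    if "continuous_on {a..b} w" "t \<le> b" for w t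
  proof -
    have "continuous_on {a..b} (\<lambda>s. (\<lambda>(t, y). F t y) (s, e s *\<^sub>R w s))"
      by (rule continuous_on_compose2[OF cont]) (auto intro!: continuous_intros e_cont that)
    then show ?thesis using that(2) by (auto intro: continuous_on_subset)
  qed
  have J_deriv: "(J w has_vector_derivative F t (e t *\<^sub>R w t)) (at t within {a..b})"
    if "continuous_on {a..b} w" "t \<in> {a..b}" for w t
    unfolding J_def
    using integral_has_vector_derivative[OF integrand[OF that(1) order_refl] that(2)]
    by (auto intro!: derivative_eq_intros)
  have J_cont: "continuous_on {a..b} (J w)" if "continuous_on {a..b} w" for w
    using J_deriv[OF that] by (rule continuous_on_vector_derivative)
  \<comment> \<open>the unknown \<open>w\<close> is the solution divided by the weight, which turns the weighted norm into the plain one\<close>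
  define P where "P w = Bcontfun (\<lambda>t. inverse (e (c t)) *\<^sub>R J (apply_bcontfun w) (c t))" for w
  have P_apply: "apply_bcontfun (P w) t = inverse (e (c t)) *\<^sub>R J (apply_bcontfun w) (c t)" for w t
  proof -
    let ?h = "\<lambda>t. inverse (e t) *\<^sub>R J (apply_bcontfun w) t"
    have h: "continuous_on {a..b} ?h"
      using e_pos by (intro continuous_intros e_cont J_cont) (auto simp: less_imp_neq[THEN not_sym])
    have "continuous_on UNIV (\<lambda>t. ?h (c t))"
      by (rule continuous_on_compose2[OF h]) (use c_in in \<open>auto simp: c_def intro!: continuous_intros\<close>)
    moreover have "bounded (range (\<lambda>t. ?h (c t)))"
      by (rule bounded_subset[OF compact_imp_bounded[OF compact_continuous_image[OF h compact_Icc]]])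
         (use c_in in auto)
    ultimately have "(\<lambda>t. ?h (c t)) \<in> bcontfun" by (simp add: bcontfun_def)
    then show ?thesis unfolding P_def by (simp add: Bcontfun_inverse)
  qed
  have contraction: "dist (P w) (P z) \<le> 1/2 * dist w z" for w z
  proof (rule dist_bound)
    fix t
    define \<tau> where "\<tau> = c t"
    have \<tau>: "a \<le> \<tau>" "\<tau> \<le> b" using c_in[of t] by (auto simp: \<tau>_def)
    let ?F = "\<lambda>w s. F s (e s *\<^sub>R apply_bcontfun w s)"
    have int: "?F w integrable_on {a..\<tau>}" for w
      by (rule integrable_continuous_real[OF integrand]) (use \<tau> in auto)
    have bnd_int: "((\<lambda>s. L * (e s * dist w z)) has_integral
         (e \<tau> * (dist w z / 2) - e a * (dist w z / 2))) {a..\<tau>}"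
    proof (rule fundamental_theorem_of_calculus[OF \<tau>(1)])
      fix s
      show "((\<lambda>s. e s * (dist w z / 2)) has_vector_derivative L * (e s * dist w z)) (at s within {a..\<tau>})"
        unfolding has_real_derivative_iff_has_vector_derivative[symmetric] e_def
        by (auto intro!: derivative_eq_intros)
    qed
    have "norm (integral {a..\<tau>} (\<lambda>s. ?F w s - ?F z s)) \<le> integral {a..\<tau>} (\<lambda>s. L * (e s * dist w z))"
    proof (rule integral_norm_bound_integral)
      fix s assume s: "s \<in> {a..\<tau>}"
      have "norm (?F w s - ?F z s) \<le> L * norm (e s *\<^sub>R apply_bcontfun w s - e s *\<^sub>R apply_bcontfun z s)"
        using s \<tau> by (intro lip) auto
      also have "\<dots> = L * (e s * dist (apply_bcontfun w s) (apply_bcontfun z s))"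
        using e_pos[of s] by (simp flip: scaleR_right_diff_distrib add: dist_norm)
      also have "\<dots> \<le> L * (e s * dist w z)"
        using L e_pos[of s] by (intro mult_left_mono dist_bounded) auto
      finally show "norm (?F w s - ?F z s) \<le> L * (e s * dist w z)" .
    qed (use int bnd_int in \<open>auto intro: integrable_diff has_integral_integrable\<close>)
    also have "\<dots> = e \<tau> * (dist w z / 2) - e a * (dist w z / 2)"
      using bnd_int by (rule integral_unique)
    also have "\<dots> \<le> e \<tau> * (dist w z / 2)" using e_pos[of a] by simp
    finally have *: "norm (integral {a..\<tau>} (?F w) - integral {a..\<tau>} (?F z)) \<le> e \<tau> * (dist w z / 2)"
      by (simp add: integral_diff int)
    have "dist (apply_bcontfun (P w) t) (apply_bcontfun (P z) t)
        = inverse (e \<tau>) * norm (integral {a..\<tau>} (?F w) - integral {a..\<tau>} (?F z))"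
      using e_pos[of \<tau>]
      by (simp add: P_apply \<tau>_def[symmetric] J_def dist_norm flip: scaleR_right_diff_distrib)
    also have "\<dots> \<le> inverse (e \<tau>) * (e \<tau> * (dist w z / 2))"
      using e_pos[of \<tau>] by (intro mult_left_mono *) auto
    also have "\<dots> = 1/2 * dist w z" using e_pos[of \<tau>] by simp
    finally show "dist (apply_bcontfun (P w) t) (apply_bcontfun (P z) t) \<le> 1/2 * dist w z" .
  qed
  obtain w where w: "P w = w"
    using banach_fix_type[of "1/2" P] contraction by auto
  define y where "y = J (apply_bcontfun w)"
  have y_eq: "e t *\<^sub>R apply_bcontfun w t = y t" if "t \<in> {a..b}" for t
  proof -
    have "e t *\<^sub>R apply_bcontfun (P w) t = y t"
      unfolding P_apply y_def using e_pos[of t] by (simp add: c_id[OF that])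
    then show ?thesis by (simp add: w)
  qed
  show thesis
  proof
    show "y a = y0" by (simp add: y_def J_def)
    show "(y has_vector_derivative F t (y t)) (at t within {a..b})" if "t \<in> {a..b}" for t
      using J_deriv[of "apply_bcontfun w" t] that y_eq[OF that] by (simp add: y_def)
  qed
qed

section \<open>The nonlinearity and the explicit singular solution\<close>

text \<open>The two one-sided difference quotients at \<open>c\<close> have the same limit, so each branch needs a
  derivative only on its own side of \<open>c\<close>.\<close>

lemma has_real_derivative_glue:
  fixes f g :: "real \<Rightarrow> real"
  assumes left: "x \<le> c \<Longrightarrow> (f has_real_derivative d) (at x within {a..c})"
    and right: "c \<le> x \<Longrightarrow> (g has_real_derivative d) (at x within {c..b})"
    and "f c = g c" "a < x" "x < b" "a < c" "c < b"
  shows "((\<lambda>x. if x \<le> c then f x else g x) has_real_derivative d) (at x)"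
proof -
  let ?h = "\<lambda>x. if x \<le> c then f x else g x"
  have "(?h has_real_derivative d) (at x within {a..c})" if "x \<le> c"
    by (rule has_field_derivative_transform_within[OF left[OF that], where d = 1])
       (use assms that in auto)
  moreover have "(?h has_real_derivative d) (at x within {c..b})" if "c \<le> x"
    by (rule has_field_derivative_transform_within[OF right[OF that], where d = 1])
       (use assms that in auto)
  moreover have "at x within {a..c} = at x" if "x < c"
    using that assms by (intro at_within_interior) auto
  moreover have "at x within {c..b} = at x" if "c < x"
    using that assms by (intro at_within_interior) auto
  moreover have "(?h has_real_derivative d) (at c)"
    if "(?h has_real_derivative d) (at c within {a..c})" "(?h has_real_derivative d) (at c within {c..b})"
  proof -
    have "at c = at c within {a..b}"
      using assms by (intro at_within_interior[symmetric]) auto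
    also have "{a..b} = {a..c} \<union> {c..b}" using assms by auto
    finally have "at c = sup (at c within {a..c}) (at c within {c..b})" by (simp add: at_within_union)
    then show ?thesis using that unfolding has_field_derivative_iff by (simp add: filterlim_sup)
  qed
  ultimately show ?thesis by (cases x c rule: linorder_cases) auto
qed

lemma beta_pos: "beta > 0" and beta_sq: "beta\<^sup>2 = 5/2"
  by (simp_all add: beta_def)

lemma alpha_pos: "alpha > 0"
  by (simp add: alpha_def)

text \<open>The choice of \<open>alpha\<close> makes the two branches of the nonlinearity agree at \<open>beta\<close>, which gives its
  continuity and lets either formula be used there.\<close>

lemma nonlinearity_match: "1 / beta ^ 3 * exp (beta\<^sup>2) = alpha * beta\<^sup>2"
proof -
  have "(5/2::real) powr (5/2) = beta ^ 5"
    unfolding beta_def by (simp add: powr_half_sqrt[symmetric] powr_powr flip: powr_realpow)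
  then have "alpha = exp (beta\<^sup>2) / beta ^ 5" by (simp add: alpha_def beta_sq)
  then show ?thesis using beta_pos by (simp add: field_simps eval_nat_numeral)
qed

lemma nonlinearity_large: "s \<ge> beta \<Longrightarrow> nonlinearity s = exp (s\<^sup>2) / s ^ 3"
  using nonlinearity_match beta_pos
  by (cases "s = beta") (auto simp: nonlinearity_def)

lemma nonlinearity_small: "0 \<le> s \<Longrightarrow> s \<le> beta \<Longrightarrow> nonlinearity s = alpha * s\<^sup>2"
  by (simp add: nonlinearity_def)

lemma nonlinearity_nonneg: "nonlinearity s \<ge> 0"
  using alpha_pos by (simp add: nonlinearity_def)

lemma continuous_nonlinearity: "continuous_on S nonlinearity"
proof -
  \<comment> \<open>clamping the argument into each branch, the common value at \<open>beta\<close> being counted once\<close>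
  have "nonlinearity s = exp ((max \<bar>s\<bar> beta)\<^sup>2) / max \<bar>s\<bar> beta ^ 3 + alpha * ((min \<bar>s\<bar> beta)\<^sup>2 - beta\<^sup>2)" for s
    using nonlinearity_match by (auto simp: nonlinearity_def max_def min_def algebra_simps)
  then have eq: "nonlinearity = (\<lambda>s. exp ((max \<bar>s\<bar> beta)\<^sup>2) / max \<bar>s\<bar> beta ^ 3
      + alpha * ((min \<bar>s\<bar> beta)\<^sup>2 - beta\<^sup>2))"
    by (rule ext)
  show ?thesis
    unfolding eq using beta_pos by (intro continuous_intros) auto
qed

text \<open>The explicit solution of the system near the singularity. The power
  \<open>sqrt (- ln s) ^ 3\<close> produced by differentiating the flux is the one in the nonlinearity, and
  \<open>exp ((sqrt (- ln s))\<^sup>2)\<close> is \<open>1 / s\<close>.\<close>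

lemma singular_profile_derivs:
  assumes "0 < s" "s \<le> exp (-5/2)"
  shows "((\<lambda>s. sqrt (- ln s)) has_real_derivative (- 1 / (2 * sqrt (- ln s))) / s) (at s)"
    and "((\<lambda>s. - 1 / (2 * sqrt (- ln s))) has_real_derivative - nonlinearity (sqrt (- ln s)) / 4) (at s)"
    and "nonlinearity (sqrt (- ln s)) = 1 / (s * sqrt (- ln s) ^ 3)"
    and "beta \<le> sqrt (- ln s)"
proof -
  have L: "- ln s \<ge> 5/2"
  proof -
    have "ln s \<le> ln (exp (-5/2))" using assms by (subst ln_le_cancel_iff) auto
    then show ?thesis by simp
  qed
  show b: "beta \<le> sqrt (- ln s)" unfolding beta_def using L by (rule real_sqrt_le_mono)
  have e: "exp (- ln s) = 1 / s" using assms by (simp add: exp_minus field_simps)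
  have sq: "(sqrt (- ln s))\<^sup>2 = - ln s" using L by simp
  show nl: "nonlinearity (sqrt (- ln s)) = 1 / (s * sqrt (- ln s) ^ 3)"
    using nonlinearity_large[OF b] e unfolding sq by simp
  show d: "((\<lambda>s. sqrt (- ln s)) has_real_derivative (- 1 / (2 * sqrt (- ln s))) / s) (at s)"
    using assms L by (auto intro!: derivative_eq_intros simp: field_simps)
  have "((\<lambda>s. - 1 / (2 * h s)) has_real_derivative D / (2 * (h s)\<^sup>2)) (at s)"
    if "(h has_real_derivative D) (at s)" "h s \<noteq> 0" for h :: "real \<Rightarrow> real" and D
    using that(2) by (auto intro!: derivative_eq_intros that(1) simp: field_simps power2_eq_square)
  from this[OF d] L
  show "((\<lambda>s. - 1 / (2 * sqrt (- ln s))) has_real_derivative - nonlinearity (sqrt (- ln s)) / 4) (at s)"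
    unfolding nl by (simp add: power3_eq_cube power2_eq_square mult_ac)
qed

section \<open>The radial profile\<close>

text \<open>Continuation to the right of \<open>exp (-5/2)\<close> up to the first zero. The quadratic right-hand side is
  replaced by the globally Lipschitz \<open>q\<close>, which agrees with it on \<open>[0, beta]\<close>, where
  the solution stays until its zero because it is decreasing. Since \<open>q\<close> is nonnegative, \<open>p\<close>
  stays below its initial value \<open>- 1 / (2 * beta)\<close>, and hence \<open>y s + ln s / (2 * beta)\<close>
  is nonincreasing. The right end \<open>exp (5/2)\<close> is where this monotonicity forces \<open>y\<close> to be
  nonpositive: the logarithm has grown by \<open>5 = 2 * beta\<^sup>2\<close>.\<close>

lemma outer_profile:
  obtains s0 y p where "exp (-5/2) < s0"
    and "y (exp (-5/2)) = beta" and "p (exp (-5/2)) = - 1 / (2 * beta)" and "y s0 = 0"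
    and "\<And>s. s \<in> {exp (-5/2)..<s0} \<Longrightarrow> 0 < y s \<and> y s \<le> beta"
    and "\<And>s. s \<in> {exp (-5/2)..s0} \<Longrightarrow>
          (y has_real_derivative p s / s) (at s within {exp (-5/2)..s0})"
    and "\<And>s. s \<in> {exp (-5/2)..s0} \<Longrightarrow>
          (p has_real_derivative - nonlinearity (y s) / 4) (at s within {exp (-5/2)..s0})"
proof -
  define a b :: real where "a = exp (-5/2)" and "b = exp (5/2)"
  have ab: "0 < a" "a < b" by (simp_all add: a_def b_def)
  define q where "q y = alpha * (max 0 (min beta y))\<^sup>2 / 4" for y
  define F where "F s z = (snd z / s, - q (fst z))" for s and z :: "real \<times> real"
  have q_nonneg: "q y \<ge> 0" for y using alpha_pos by (simp add: q_def)
  have q_lip: "\<bar>q y - q z\<bar> \<le> alpha * beta / 2 * \<bar>y - z\<bar>" for y z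
  proof -
    define y' z' where "y' = max 0 (min beta y)" and "z' = max 0 (min beta z)"
    have "q y - q z = alpha / 4 * ((y' + z') * (y' - z'))"
      by (simp add: q_def y'_def[symmetric] z'_def[symmetric] power2_eq_square field_simps)
    then have "\<bar>q y - q z\<bar> = alpha / 4 * (\<bar>y' + z'\<bar> * \<bar>y' - z'\<bar>)"
      using alpha_pos by (simp only: abs_mult abs_of_pos[of "alpha / 4"])
    also have "\<dots> \<le> alpha / 4 * ((2 * beta) * \<bar>y - z\<bar>)"
      using alpha_pos beta_pos by (intro mult_left_mono mult_mono) (auto simp: y'_def z'_def)
    finally show ?thesis by simp
  qed
  obtain w where w0: "w a = (beta, - 1 / (2 * beta))"
    and w: "\<And>t. t \<in> {a..b} \<Longrightarrow> (w has_vector_derivative F t (w t)) (at t within {a..b})"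
  proof (rule picard_lindelof_global[of a b F "1 / a + alpha * beta / 2"])
    show "continuous_on ({a..b} \<times> UNIV) (\<lambda>(t, y). F t y)"
      unfolding F_def q_def case_prod_unfold using ab by (intro continuous_intros) auto
    fix t :: real and y z :: "real \<times> real" assume t: "t \<in> {a..b}"
    have "norm (F t y - F t z) \<le> norm (snd y / t - snd z / t) + norm (- q (fst y) - (- q (fst z)))"
      unfolding F_def by (simp add: norm_Pair_le[THEN order_trans])
    also have "norm (snd y / t - snd z / t) = 1 / t * \<bar>snd (y - z)\<bar>"
      using t ab by (simp add: abs_mult flip: diff_divide_distrib)
    also have "\<dots> \<le> 1 / a * norm (y - z)"
      using t ab norm_snd_le[of "snd (y - z)" "fst (y - z)"]
      by (intro mult_mono) (auto simp: frac_le simp del: fst_diff snd_diff)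
    also have "norm (- q (fst y) - (- q (fst z))) \<le> alpha * beta / 2 * \<bar>fst y - fst z\<bar>"
      using q_lip[of "fst y" "fst z"] unfolding real_norm_def by linarith
    also have "\<dots> \<le> alpha * beta / 2 * norm (y - z)"
      using alpha_pos beta_pos norm_fst_le[of "fst (y - z)" "snd (y - z)"]
      by (intro mult_left_mono) (auto simp del: fst_diff snd_diff simp flip: fst_diff)
    finally show "norm (F t y - F t z) \<le> (1 / a + alpha * beta / 2) * norm (y - z)"
      by (simp add: algebra_simps)
  qed (use ab alpha_pos beta_pos in \<open>auto intro!: add_pos_pos\<close>)
  define y p where "y = (\<lambda>s. fst (w s))" and "p = (\<lambda>s. snd (w s))"
  have y0: "y a = beta" and p0: "p a = - 1 / (2 * beta)" by (simp_all add: y_def p_def w0)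
  have dy: "(y has_real_derivative p s / s) (at s within {a..b})"
    and dp: "(p has_real_derivative - q (y s)) (at s within {a..b})" if "s \<in> {a..b}" for s
    using bounded_linear.has_vector_derivative[OF bounded_linear_fst w[OF that]]
      bounded_linear.has_vector_derivative[OF bounded_linear_snd w[OF that]]
    by (auto simp: has_real_derivative_iff_has_vector_derivative y_def p_def F_def)
  have at_eq: "at s within {a..b} = at s" if "a < s" "s < b" for s
    using that by (intro at_within_interior) auto
  have cy: "continuous_on {a..b} y" and cp: "continuous_on {a..b} p"
    by (rule DERIV_continuous_on, rule dy dp, assumption)+
  have p_le: "p s \<le> - 1 / (2 * beta)" if s: "s \<in> {a..b}" for s
    unfolding p0[symmetric]
  proof (rule DERIV_nonpos_imp_decreasing_open[where f = p])
    show "\<exists>d. (p has_real_derivative d) (at x) \<and> d \<le> 0" if "a < x" "x < s" for x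
      using dp[of x] at_eq[of x] q_nonneg[of "y x"] that s by force
  qed (use s cp in \<open>auto intro: continuous_on_subset\<close>)
  have p_neg: "p s < 0" if s: "s \<in> {a..b}" for s
    using p_le[OF s] beta_pos by (smt (verit) divide_neg_pos)
  \<comment> \<open>the derivative is \<open>(p s + 1 / (2 * beta)) / s\<close>, and \<open>p\<close> starts at \<open>- 1 / (2 * beta)\<close>\<close>
  have "y b + ln b / (2 * beta) \<le> y a + ln a / (2 * beta)"
  proof (rule DERIV_nonpos_imp_decreasing_open[where f = "\<lambda>s. y s + ln s / (2 * beta)"])
    fix x assume x: "a < x" "x < b"
    have "((\<lambda>s. y s + ln s / (2 * beta)) has_real_derivative p x / x + (1 / x) / (2 * beta)) (at x)"
      using dy[of x] at_eq[OF x] x ab beta_pos by (auto intro!: derivative_eq_intros)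
    moreover have "p x / x + (1 / x) / (2 * beta) \<le> 0"
    proof -
      have "p x / x + (1 / x) / (2 * beta) = (p x + 1 / (2 * beta)) / x"
        by (simp add: add_divide_distrib)
      also have "\<dots> \<le> 0" using p_le[of x] x ab by (intro divide_nonpos_pos) auto
      finally show ?thesis .
    qed
    ultimately show "\<exists>d. ((\<lambda>s. y s + ln s / (2 * beta)) has_real_derivative d) (at x) \<and> d \<le> 0" by blast
  qed (use ab beta_pos in \<open>auto intro!: continuous_intros cy\<close>)
  then have "y b \<le> beta - 5 / (2 * beta)" unfolding y0 by (simp add: a_def b_def field_simps)
  also have "\<dots> = 0" using beta_sq beta_pos by (simp add: field_simps power2_eq_square)
  finally have "y b \<le> 0" .
  then obtain s0 where s0: "a \<le> s0" "s0 \<le> b" "y s0 = 0"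
    using IVT2'[of y b 0 a] y0 beta_pos ab cy by auto
  have "a < s0" using s0 y0 beta_pos by (cases "a = s0") auto
  have y_dec: "y t < y s" if "s < t" "s \<in> {a..s0}" "t \<in> {a..s0}" for s t
  proof (rule DERIV_neg_imp_decreasing_open[where f = y, OF that(1)])
    show "\<exists>d. (y has_real_derivative d) (at x) \<and> d < 0" if "s < x" "x < t" for x
      using that \<open>s \<in> _\<close> \<open>t \<in> _\<close> s0 ab dy[of x] at_eq[of x] p_neg[of x]
      by (intro exI[of _ "p x / x"]) (auto intro: divide_neg_pos)
  qed (use that s0 in \<open>auto intro: continuous_on_subset[OF cy]\<close>)
  have y_bd: "0 < y s \<and> y s \<le> beta" if "s \<in> {a..<s0}" for s
    using y_dec[of s s0] y_dec[of a s] that s0 y0 by (cases "s = a") (auto simp: \<open>a < s0\<close>)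
  have q_eq: "q (y s) = nonlinearity (y s) / 4" if "s \<in> {a..s0}" for s
    using y_bd[of s] s0 that beta_pos nonlinearity_small[of "y s"] by (cases "s = s0") (auto simp: q_def)
  show thesis
  proof (rule that[of s0 y p, folded a_def])
    show "(y has_real_derivative p s / s) (at s within {a..s0})"
      and "(p has_real_derivative - nonlinearity (y s) / 4) (at s within {a..s0})"
      if "s \<in> {a..s0}" for s
      using dy[of s] dp[of s] that s0 q_eq[OF that]
      by (auto intro: has_field_derivative_subset)
  qed (use \<open>a < s0\<close> y0 p0 s0 y_bd in auto)
qed

text \<open>What the rest of the proof needs of the radial profile \<open>g\<close> as a function of the squared radius,
  together with its flux \<open>p s = s * g' s\<close>. In terms of \<open>p\<close> the radial equation reads
  \<open>p' = - nonlinearity (g s) / 4\<close>, so pieces of solutions fit together as soon as \<open>g\<close> and \<open>p\<close> do.\<close>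

locale singular_profile =
  fixes s0 :: real and g p :: "real \<Rightarrow> real"
  assumes s0: "exp (-5/2) < s0"
    and g_inner: "0 < s \<Longrightarrow> s \<le> exp (-5/2) \<Longrightarrow> g s = sqrt (- ln s)"
    and p_inner: "0 < s \<Longrightarrow> s \<le> exp (-5/2) \<Longrightarrow> p s = - 1 / (2 * sqrt (- ln s))"
    and g_outer: "exp (-5/2) \<le> s \<Longrightarrow> s < s0 \<Longrightarrow> 0 < g s \<and> g s \<le> beta"
    and g_boundary: "g s0 = 0"
    and g_cont: "continuous_on {0<..s0} g"
    and p_cont: "continuous_on {exp (-5/2)..s0} p"
    and g_deriv: "0 < s \<Longrightarrow> s < s0 \<Longrightarrow> (g has_real_derivative p s / s) (at s)"
    and p_deriv: "0 < s \<Longrightarrow> s < s0 \<Longrightarrow> (p has_real_derivative - nonlinearity (g s) / 4) (at s)"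

lemma singular_profile_exists: "\<exists>s0 g p. singular_profile s0 g p"
proof -
  define a :: real where "a = exp (-5/2)"
  have a: "0 < a" by (simp add: a_def)
  have sqrt_a: "sqrt (- ln a) = beta" by (simp add: a_def beta_def)
  obtain s0 y r where s0: "a < s0" and y0: "y a = beta" and r0: "r a = - 1 / (2 * beta)"
    and ys0: "y s0 = 0"
    and y_bd: "\<And>s. s \<in> {a..<s0} \<Longrightarrow> 0 < y s \<and> y s \<le> beta"
    and dy: "\<And>s. s \<in> {a..s0} \<Longrightarrow> (y has_real_derivative r s / s) (at s within {a..s0})"
    and dr: "\<And>s. s \<in> {a..s0} \<Longrightarrow>
          (r has_real_derivative - nonlinearity (y s) / 4) (at s within {a..s0})"
    apply (rule outer_profile[folded a_def])
    subgoal for s0 y r by (rule that[of s0 y r])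
    done
  define g where "g = (\<lambda>s. if s \<le> a then sqrt (- ln s) else y s)"
  define p where "p = (\<lambda>s. if s \<le> a then - 1 / (2 * sqrt (- ln s)) else r s)"
  have g_right: "g s = y s" and p_right: "p s = r s" if "a \<le> s" for s
    using that by (auto simp: g_def p_def sqrt_a y0 r0)
  have dg: "(g has_real_derivative p s / s) (at s)" if "0 < s" "s < s0" for s
    unfolding g_def
  proof (rule has_real_derivative_glue[where a = 0 and b = s0])
    show "((\<lambda>s. sqrt (- ln s)) has_real_derivative p s / s) (at s within {0..a})" if "s \<le> a"
      using singular_profile_derivs(1)[of s] that \<open>0 < s\<close>
      by (auto simp: p_def a_def intro: has_field_derivative_at_within)
    show "(y has_real_derivative p s / s) (at s within {a..s0})" if "a \<le> s"
      using dy[of s] p_right[OF that] that \<open>s < s0\<close> by simp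
  qed (use that s0 a sqrt_a y0 in auto)
  have dp: "(p has_real_derivative - nonlinearity (g s) / 4) (at s)" if "0 < s" "s < s0" for s
    unfolding p_def
  proof (rule has_real_derivative_glue[where a = 0 and b = s0])
    show "((\<lambda>s. - 1 / (2 * sqrt (- ln s))) has_real_derivative - nonlinearity (g s) / 4)
        (at s within {0..a})" if "s \<le> a"
      using singular_profile_derivs(2)[of s] that \<open>0 < s\<close>
      by (auto simp: g_def a_def intro: has_field_derivative_at_within)
    show "(r has_real_derivative - nonlinearity (g s) / 4) (at s within {a..s0})" if "a \<le> s"
      using dr[of s] g_right[OF that] that \<open>s < s0\<close> by simp
  qed (use that s0 a sqrt_a r0 in auto)
  have "continuous_on {a..s0} y" by (rule DERIV_continuous_on[OF dy])
  moreover have "continuous_on {a..s0} r" by (rule DERIV_continuous_on[OF dr])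
  ultimately have cg: "continuous_on {a..s0} g" and cp: "continuous_on {a..s0} p"
    by (simp_all add: g_right p_right cong: continuous_on_cong_simp)
  have "continuous_on {0<..a} g"
  proof -
    have "isCont g s" if "s \<in> {0<..a}" for s
      using dg[of s] that s0 by (auto intro: DERIV_isCont)
    then show ?thesis by (auto intro: continuous_at_imp_continuous_on)
  qed
  have "continuous_on {0<..s0} g"
    unfolding continuous_on_eq_continuous_within
  proof
    fix s assume s: "s \<in> {0<..s0}"
    show "continuous (at s within {0<..s0}) g"
    proof (cases "s < s0")
      case True
      then show ?thesis using dg[of s] s by (auto intro: DERIV_isCont continuous_at_imp_continuous_at_within)
    next
      case False
      then have "at s within {0<..s0} = at s within {a..s0}"
        using s s0 a by (intro at_within_nhd[of _ "{a<..}"]) auto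
      then show ?thesis using cg s s0 False by (auto simp: continuous_on_eq_continuous_within)
    qed
  qed
  have "singular_profile s0 g p"
    unfolding singular_profile_def a_def[symmetric]
  proof (intro conjI allI impI)
    show "g s = sqrt (- ln s)" if "s \<le> a" for s using that by (simp add: g_def)
    show "p s = - 1 / (2 * sqrt (- ln s))" if "s \<le> a" for s using that by (simp add: p_def)
    show "0 < g s" "g s \<le> beta" if "a \<le> s" "s < s0" for s
      using g_right[of s] y_bd[of s] that by auto
    show "g s0 = 0" using g_right[of s0] s0 ys0 by simp
  qed (fact s0 \<open>continuous_on {0<..s0} g\<close> cp | rule dg dp, assumption+)+
  then show ?thesis by blast
qed

section \<open>Radial functions and their Laplacian\<close>

lemma partial_deriv_eqI:
  "((\<lambda>t. u (x + t *\<^sub>R i)) has_real_derivative d) (at 0) \<Longrightarrow> partial_deriv i u x = d"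
  by (simp add: partial_deriv_def DERIV_imp_deriv)

lemma eventually_line_in_open:
  fixes x i :: "'a::real_normed_vector"
  assumes "open S" "x \<in> S"
  shows "\<forall>\<^sub>F t in nhds (0::real). x + t *\<^sub>R i \<in> S"
proof -
  have "open ((\<lambda>t::real. x + t *\<^sub>R i) -` S)"
    by (intro open_vimage assms continuous_intros)
  moreover have "0 \<in> (\<lambda>t::real. x + t *\<^sub>R i) -` S" using assms by simp
  ultimately show ?thesis by (auto simp: eventually_nhds)
qed

lemma line_derivative_cong:
  fixes u v :: "'a::euclidean_space \<Rightarrow> real"
  assumes "open S" "x \<in> S" "\<And>y. y \<in> S \<Longrightarrow> u y = v y"
  shows "((\<lambda>t. u (x + t *\<^sub>R i)) has_real_derivative d) (at 0)
     \<longleftrightarrow> ((\<lambda>t. v (x + t *\<^sub>R i)) has_real_derivative d) (at 0)"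
proof (rule DERIV_cong_ev)
  show "\<forall>\<^sub>F t in nhds 0. u (x + t *\<^sub>R i) = v (x + t *\<^sub>R i)"
    using eventually_line_in_open[OF assms(1,2)] by eventually_elim (rule assms(3))
qed simp_all

text \<open>On an open set, partial derivatives depend only on the values there; this is what allows second
  partial derivatives to be computed from a formula for the first ones.\<close>

lemma partial_deriv_cong:
  fixes u v :: "'a::euclidean_space \<Rightarrow> real"
  assumes "open S" "x \<in> S" "\<And>y. y \<in> S \<Longrightarrow> u y = v y"
  shows "partial_deriv i u x = partial_deriv i v x"
  unfolding partial_deriv_def deriv_def
  by (intro arg_cong[where f = Eps] ext line_derivative_cong[of S x u v, OF assms])

lemma Ck_on_cong:
  assumes "open S" "\<And>y. y \<in> S \<Longrightarrow> u y = v y"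
  shows "Ck_on k u S \<longleftrightarrow> Ck_on k v S"
  using assms(2)
proof (induction k arbitrary: u v)
  case 0
  then show ?case by (auto cong: continuous_on_cong)
next
  case (Suc k)
  have "Ck_on k (partial_deriv i u) S \<longleftrightarrow> Ck_on k (partial_deriv i v) S" for i
    by (rule Suc.IH) (rule partial_deriv_cong[OF assms(1)], use Suc.prems in auto)
  moreover have "(\<lambda>t. u (x + t *\<^sub>R i)) differentiable at 0 \<longleftrightarrow> (\<lambda>t. v (x + t *\<^sub>R i)) differentiable at 0"
    if "x \<in> S" for x i
    using line_derivative_cong[of S x u v, OF assms(1) that Suc.prems]
    by (auto simp: real_differentiable_def)
  moreover have "continuous_on S u \<longleftrightarrow> continuous_on S v"
    using Suc.prems by (auto cong: continuous_on_cong)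
  ultimately show ?case by simp
qed

text \<open>Membership in \<open>Ck_on\<close> can be checked on explicit formulas \<open>D\<close> for the partial derivatives,
  valid on the open set only.\<close>

lemma Ck_on_SucI:
  assumes "open S" "continuous_on S u"
    and "\<And>i x. i \<in> Basis \<Longrightarrow> x \<in> S \<Longrightarrow> ((\<lambda>t. u (x + t *\<^sub>R i)) has_real_derivative D i x) (at 0)"
    and "\<And>i. i \<in> Basis \<Longrightarrow> Ck_on k (D i) S"
  shows "Ck_on (Suc k) u S"
proof -
  have "Ck_on k (partial_deriv i u) S" if "i \<in> Basis" for i
    using assms(4)[OF that] partial_deriv_eqI[OF assms(3)[OF that]]
    by (subst Ck_on_cong[OF assms(1), of _ "D i"]) auto
  then show ?thesis using assms(2,3) by (auto simp: real_differentiable_def)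
qed

lemma Ck_on_SucD:
  assumes "Ck_on (Suc k) u S" "i \<in> Basis"
  shows "continuous_on S u" "Ck_on k (partial_deriv i u) S"
    and "x \<in> S \<Longrightarrow> ((\<lambda>t. u (x + t *\<^sub>R i)) has_real_derivative partial_deriv i u x) (at 0)"
proof -
  show "((\<lambda>t. u (x + t *\<^sub>R i)) has_real_derivative partial_deriv i u x) (at 0)" if "x \<in> S"
  proof -
    have "(\<lambda>t. u (x + t *\<^sub>R i)) differentiable at 0" using assms that by simp
    then obtain d where d: "((\<lambda>t. u (x + t *\<^sub>R i)) has_real_derivative d) (at 0)"
      by (auto simp: real_differentiable_def)
    then show ?thesis using partial_deriv_eqI[OF d] by simp
  qed
qed (use assms in auto)

text \<open>Radial functions are written in terms of the squared norm, which is smooth at the origin; so \<open>I\<close>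
  may contain \<open>0\<close>, and the punctured and the full ball are treated alike.\<close>

lemma
  fixes g g' g'' :: "real \<Rightarrow> real"
  defines "u \<equiv> \<lambda>x::'a::euclidean_space. g (x \<bullet> x)"
  assumes I: "open I"
    and g': "\<And>s. s \<in> I \<Longrightarrow> (g has_real_derivative g' s) (at s)"
    and g'': "\<And>s. s \<in> I \<Longrightarrow> (g' has_real_derivative g'' s) (at s)"
    and cont: "continuous_on I g''"
  shows Ck_on_2_radial: "Ck_on 2 u {x. x \<bullet> x \<in> I}"
    and laplacian_radial: "\<And>x. x \<bullet> x \<in> I \<Longrightarrow>
      laplacian u x = 4 * (x \<bullet> x) * g'' (x \<bullet> x) + 2 * real DIM('a) * g' (x \<bullet> x)"
proof -
  let ?S = "{x::'a. x \<bullet> x \<in> I}"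
  have S: "open ?S"
    using open_vimage[OF I, of "\<lambda>x::'a. x \<bullet> x"] by (simp add: vimage_def continuous_intros)
  have inner_deriv: "((\<lambda>t. (x + t *\<^sub>R i) \<bullet> (x + t *\<^sub>R i)) has_real_derivative 2 * (x \<bullet> i)) (at 0)"
    for x i :: 'a
    by (auto intro!: derivative_eq_intros simp: has_real_derivative_iff_has_vector_derivative
        has_vector_derivative_def inner_commute algebra_simps)
  have comp: "((\<lambda>t. h ((x + t *\<^sub>R i) \<bullet> (x + t *\<^sub>R i))) has_real_derivative d * (2 * (x \<bullet> i))) (at 0)"
    if "(h has_real_derivative d) (at (x \<bullet> x))" for h d and x i :: 'a
    using DERIV_chain2[of h d "\<lambda>t. (x + t *\<^sub>R i) \<bullet> (x + t *\<^sub>R i)" 0, OF _ inner_deriv] that by simp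
  define D where "D i x = g' (x \<bullet> x) * (2 * (x \<bullet> i))" for i x :: 'a
  define E where "E i j x = g'' (x \<bullet> x) * (2 * (x \<bullet> j)) * (2 * (x \<bullet> i)) + g' (x \<bullet> x) * (2 * (j \<bullet> i))"
    for i j x :: 'a
  have du: "((\<lambda>t. u (x + t *\<^sub>R i)) has_real_derivative D i x) (at 0)" if "x \<in> ?S" for x i
    unfolding u_def D_def by (rule comp) (use that g' in auto)
  have dD: "((\<lambda>t. D i (x + t *\<^sub>R j)) has_real_derivative E i j x) (at 0)" if "x \<in> ?S" for x i j
  proof -
    have "((\<lambda>t. 2 * ((x + t *\<^sub>R j) \<bullet> i)) has_real_derivative 2 * (j \<bullet> i)) (at 0)"
      by (auto intro!: derivative_eq_intros simp: inner_add_left)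
    from DERIV_mult[OF comp[OF g''] this, of x j] that
    show ?thesis unfolding D_def E_def by (simp add: mult.commute)
  qed
  have cg: "continuous_on I g" and cg': "continuous_on I g'"
    using g' g'' by (auto intro!: continuous_at_imp_continuous_on DERIV_isCont)
  have c: "continuous_on ?S (\<lambda>x. h (x \<bullet> x))" if "continuous_on I h" for h :: "real \<Rightarrow> real"
    by (rule continuous_on_compose2[OF that]) (auto intro!: continuous_intros)
  have cE: "continuous_on ?S (E i j)" for i j
    unfolding E_def by (intro continuous_intros c cont cg')
  have cD: "continuous_on ?S (D i)" for i
    unfolding D_def by (intro continuous_intros c cg')
  have cu: "continuous_on ?S u" unfolding u_def by (rule c[OF cg])
  have "Ck_on (Suc (Suc 0)) u ?S"
    by (intro Ck_on_SucI[where D = D, OF S cu du] Ck_on_SucI[where D = "E _", OF S cD dD]) (auto simp: cE)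
  then show "Ck_on 2 u ?S" by (simp only: numeral_2_eq_2)
  fix x :: 'a assume x: "x \<bullet> x \<in> I"
  have "partial_deriv i (partial_deriv i u) x = E i i x" for i
  proof -
    have "partial_deriv i (partial_deriv i u) x = partial_deriv i (D i) x"
      by (rule partial_deriv_cong[OF S]) (use x partial_deriv_eqI[OF du] in auto)
    also have "\<dots> = E i i x" using x by (intro partial_deriv_eqI dD) auto
    finally show ?thesis .
  qed
  then have "laplacian u x = (\<Sum>i\<in>Basis. E i i x)" by (simp add: laplacian_def)
  also have "\<dots> = 4 * g'' (x \<bullet> x) * (\<Sum>i\<in>Basis. (x \<bullet> i) * (x \<bullet> i)) + 2 * g' (x \<bullet> x) * (\<Sum>i\<in>(Basis::'a set). i \<bullet> i)"
    by (simp add: E_def sum.distrib sum_distrib_left algebra_simps)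
  also have "(\<Sum>i\<in>Basis. (x \<bullet> i) * (x \<bullet> i)) = x \<bullet> x" by (rule euclidean_inner[symmetric])
  also have "(\<Sum>i\<in>(Basis::'a set). i \<bullet> i) = real DIM('a)" by simp
  finally show "laplacian u x = 4 * (x \<bullet> x) * g'' (x \<bullet> x) + 2 * real DIM('a) * g' (x \<bullet> x)"
    by (simp add: algebra_simps)
qed

section \<open>Green's identity with compact support\<close>

lemma integrable_compact_support:
  fixes g :: "'a::euclidean_space \<Rightarrow> real"
  assumes "continuous_on UNIV g" "compact K" "\<And>x. x \<notin> K \<Longrightarrow> g x = 0"
  shows "integrable lborel g"
proof -
  have "integrable lborel (\<lambda>x. indicator K x *\<^sub>R g x)"
    using assms by (intro borel_integrable_compact) (auto intro: continuous_on_subset)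
  also have "(\<lambda>x. indicator K x *\<^sub>R g x) = g"
    using assms(3) by (auto simp: indicator_def fun_eq_iff)
  finally show ?thesis .
qed

lemma partial_deriv_eq_0_outside:
  fixes g :: "'a::euclidean_space \<Rightarrow> real"
  assumes "closed K" "\<And>x. x \<notin> K \<Longrightarrow> g x = 0" "x \<notin> K"
  shows "partial_deriv i g x = 0"
proof -
  have "partial_deriv i g x = partial_deriv i (\<lambda>_. 0) x"
    by (rule partial_deriv_cong[of "- K"]) (use assms in auto)
  also have "\<dots> = 0" by (rule partial_deriv_eqI) simp
  finally show ?thesis .
qed

lemma continuous_on_extend_by_zero:
  fixes f :: "'a::topological_space \<Rightarrow> real"
  assumes "open S" "closed K" "K \<subseteq> S" "continuous_on S f" "\<And>x. x \<notin> K \<Longrightarrow> f x = 0"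
  shows "continuous_on UNIV (\<lambda>x. indicator S x * f x)"
proof -
  have "continuous_on S (\<lambda>x. indicator S x * f x)"
    by (rule continuous_on_eq[OF assms(4)]) auto
  moreover have "continuous_on (- K) (\<lambda>x. indicator S x * f x)"
    by (rule continuous_on_eq[OF continuous_on_const[of _ 0]]) (use assms(5) in auto)
  moreover have "UNIV = S \<union> - K" using assms(3) by auto
  ultimately show ?thesis using assms(1,2) by (metis continuous_on_open_Un open_Compl)
qed

text \<open>By translation invariance of Lebesgue measure the integrals of all difference quotients vanish,
  and the quotients converge boundedly on a fixed ball, by the mean value theorem. This replaces
  Fubini's theorem and the one-dimensional fundamental theorem of calculus.\<close>

lemma integral_line_derivative_eq_0:
  fixes g d :: "'a::euclidean_space \<Rightarrow> real"
  assumes cg: "continuous_on UNIV g" and cd: "continuous_on UNIV d"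
    and dg: "\<And>x. ((\<lambda>t. g (x + t *\<^sub>R i)) has_real_derivative d x) (at 0)"
    and K: "compact K" "\<And>x. x \<notin> K \<Longrightarrow> g x = 0"
  shows "integral\<^sup>L lborel d = 0"
proof -
  have d_eq: "d = partial_deriv i g" using partial_deriv_eqI[OF dg] by (simp add: fun_eq_iff)
  have dg_line: "((\<lambda>t. g (x + t *\<^sub>R i)) has_real_derivative d (x + t *\<^sub>R i)) (at t)" for x t
    using dg[of "x + t *\<^sub>R i"] DERIV_shift[of "\<lambda>t. g (x + t *\<^sub>R i)" _ 0 t]
    by (simp add: algebra_simps)
  obtain R where R: "\<And>x. x \<in> K \<Longrightarrow> norm x \<le> R"
    using compact_imp_bounded[OF K(1)] by (auto simp: bounded_iff)
  have "compact (d ` K)"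
    by (intro compact_continuous_image continuous_on_subset[OF cd] K) auto
  then obtain B' where B': "\<And>x. x \<in> K \<Longrightarrow> \<bar>d x\<bar> \<le> B'"
    using compact_imp_bounded by (fastforce simp: bounded_iff)
  define B where "B = max B' 0"
  have B: "\<bar>d x\<bar> \<le> B" for x
    unfolding d_eq using B'[unfolded d_eq, of x] partial_deriv_eq_0_outside[OF compact_imp_closed[OF K(1)] K(2), where x = x and i = i]
    by (cases "x \<in> K") (auto simp: B_def)
  define h :: "nat \<Rightarrow> real" where "h n = 1 / real (Suc n)" for n
  have h: "0 < h n" "h n \<le> 1" for n by (auto simp: h_def)
  have h0: "h \<longlonglongrightarrow> 0" unfolding h_def by (rule LIMSEQ_Suc[OF lim_1_over_n])
  define q where "q n x = (g (x + h n *\<^sub>R i) - g x) / h n" for n x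
  have q_lim: "(\<lambda>n. q n x) \<longlonglongrightarrow> d x" for x
  proof -
    have "((\<lambda>t. (g (x + t *\<^sub>R i) - g x) / t) \<longlongrightarrow> d x) (at 0)"
      using dg[of x] by (simp add: has_field_derivative_iff)
    moreover have "filterlim h (at 0) sequentially"
      using h0 h(1) by (auto simp: filterlim_at intro!: always_eventually less_imp_neq[THEN not_sym])
    ultimately show ?thesis unfolding q_def by (rule filterlim_compose)
  qed
  have q_bound: "norm (q n x) \<le> indicator (cball 0 (R + norm i)) x *\<^sub>R B" for n x
  proof (cases "norm x \<le> R + norm i")
    case True
    obtain z where "g (x + h n *\<^sub>R i) - g (x + 0 *\<^sub>R i) = (h n - 0) * d (x + z *\<^sub>R i)"
      using MVT2[OF h(1)[of n], of "\<lambda>t. g (x + t *\<^sub>R i)" "\<lambda>t. d (x + t *\<^sub>R i)"] dg_line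
      by blast
    then have "q n x = d (x + z *\<^sub>R i)"
      using h(1)[of n] by (simp add: q_def)
    then show ?thesis using True B by simp
  next
    case False
    have "norm x \<le> norm (x + h n *\<^sub>R i) + h n * norm i"
      using norm_triangle_ineq4[of "x + h n *\<^sub>R i" "h n *\<^sub>R i"] h[of n] by simp
    moreover have "h n * norm i \<le> norm i" using h[of n] by (intro mult_left_le_one_le) auto
    ultimately have "norm (x + h n *\<^sub>R i) > R" "norm x > R" using False norm_ge_zero[of i] by linarith+
    then have "x \<notin> K" "x + h n *\<^sub>R i \<notin> K" using R[of x] R[of "x + h n *\<^sub>R i"] by (meson not_less)+
    then show ?thesis using K(2) False by (simp add: q_def)
  qed
  have [measurable]: "g \<in> borel_measurable borel" "d \<in> borel_measurable borel"
    using cg cd by (auto intro: borel_measurable_continuous_onI)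
  have int_g: "integrable lborel g" by (rule integrable_compact_support[OF cg K])
  have shift: "integrable lborel (\<lambda>x. g (x + c)) \<and> (\<integral>x. g (x + c) \<partial>lborel) = integral\<^sup>L lborel g" for c
    using integrable_distr_eq[of "(+) c" lborel borel g] integral_distr[of "(+) c" lborel borel g] int_g
    by (simp add: lborel_distr_plus add.commute)
  have "(\<integral>x. q n x \<partial>lborel) = 0" for n
    unfolding q_def using shift[of "h n *\<^sub>R i"] int_g by simp
  moreover have "(\<lambda>n. \<integral>x. q n x \<partial>lborel) \<longlonglongrightarrow> integral\<^sup>L lborel (d)"
  proof (rule integral_dominated_convergence)
    show "integrable lborel (\<lambda>x. indicator (cball 0 (R + norm i)) x *\<^sub>R B :: real)"
      by (intro borel_integrable_compact) auto
    show "AE x in lborel. (\<lambda>n. q n x) \<longlonglongrightarrow> d x" using q_lim by simp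
    show "AE x in lborel. norm (q n x) \<le> indicator (cball 0 (R + norm i)) x *\<^sub>R B" for n
      using q_bound by blast
    show "q n \<in> borel_measurable lborel" for n unfolding q_def by measurable
    show "d \<in> borel_measurable lborel" by measurable
  qed
  ultimately show ?thesis by (simp add: LIMSEQ_const_iff)
qed

lemma laplacian_eq_0_outside:
  fixes g :: "'a::euclidean_space \<Rightarrow> real"
  assumes "closed K" "\<And>x. x \<notin> K \<Longrightarrow> g x = 0" "x \<notin> K"
  shows "laplacian g x = 0"
  unfolding laplacian_def
  by (intro sum.neutral ballI partial_deriv_eq_0_outside[OF assms(1)] partial_deriv_eq_0_outside[OF assms(1,2)] assms(3))

lemma continuous_laplacian:
  "Ck_on 2 u S \<Longrightarrow> continuous_on S (laplacian u)"
  unfolding laplacian_def numeral_2_eq_2 by (auto intro!: continuous_on_sum)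

text \<open>For each coordinate, \<open>v * \<phi>'' - \<phi> * v''\<close> is the derivative of \<open>v * \<phi>' - \<phi> * v'\<close>, which has
  compact support in \<open>S\<close> and is extended by zero.\<close>

lemma green_identity:
  fixes v \<phi> :: "'a::euclidean_space \<Rightarrow> real"
  assumes S: "open S" and v: "Ck_on 2 v S" and \<phi>: "Ck_on 2 \<phi> UNIV"
    and K: "compact K" "K \<subseteq> S" "\<And>x. x \<notin> K \<Longrightarrow> \<phi> x = 0"
  shows "(\<integral>x. indicator S x * (v x * laplacian \<phi> x) \<partial>lborel)
       = (\<integral>x. indicator S x * (\<phi> x * laplacian v x) \<partial>lborel)"
proof -
  note closed = compact_imp_closed[OF K(1)]
  define W where "W i x = indicator S x * (v x * partial_deriv i \<phi> x - \<phi> x * partial_deriv i v x)" for i x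
  define dW where "dW i x = indicator S x *
     (v x * partial_deriv i (partial_deriv i \<phi>) x - \<phi> x * partial_deriv i (partial_deriv i v) x)" for i x
  have v2: "Ck_on (Suc 1) v S" and \<phi>2: "Ck_on (Suc 1) \<phi> UNIV"
    using v \<phi> by (simp_all add: numeral_2_eq_2)
  have v1: "Ck_on (Suc 0) (partial_deriv i v) S" and \<phi>1: "Ck_on (Suc 0) (partial_deriv i \<phi>) UNIV" if "i \<in> Basis" for i
    using v \<phi> that by (simp_all add: numeral_2_eq_2)
  have cont: "continuous_on S v" "continuous_on S \<phi>"
    using v \<phi> by (auto simp: numeral_2_eq_2 intro: continuous_on_subset)
  have line: "((\<lambda>t. u (x + t *\<^sub>R i)) has_real_derivative partial_deriv i u x) (at 0)"
     if "Ck_on (Suc k) u T" "x \<in> T" "i \<in> Basis" for u :: "'a \<Rightarrow> real" and T x i k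
    using Ck_on_SucD(3)[OF that(1,3,2)] .
  have p\<phi>0: "partial_deriv i \<phi> x = 0" if "x \<notin> K" for i x
    by (rule partial_deriv_eq_0_outside[OF closed K(3) that])
  have pp\<phi>0: "partial_deriv i (partial_deriv i \<phi>) x = 0" if "x \<notin> K" for i x
    by (rule partial_deriv_eq_0_outside[OF closed p\<phi>0 that])
  have W0: "W i x = 0" and dW0: "dW i x = 0" if "x \<notin> K" for i x
    using that by (simp_all add: W_def dW_def K(3) p\<phi>0 pp\<phi>0)
  have cont_ext: "continuous_on UNIV (\<lambda>x. indicator S x * f x)"
    and int_ext: "integrable lborel (\<lambda>x. indicator S x * f x)"
    if "continuous_on S f" "\<And>x. x \<notin> K \<Longrightarrow> f x = 0" for f :: "'a \<Rightarrow> real"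
  proof -
    show c: "continuous_on UNIV (\<lambda>x. indicator S x * f x)"
      by (rule continuous_on_extend_by_zero[OF S closed K(2) that])
    show "integrable lborel (\<lambda>x. indicator S x * f x)"
      by (rule integrable_compact_support[OF c K(1)]) (simp add: that(2))
  qed
  have [continuous_intros]: "continuous_on S (partial_deriv i v)" "continuous_on S (partial_deriv i \<phi>)"
      "continuous_on S (partial_deriv i (partial_deriv i v))"
      "continuous_on S (partial_deriv i (partial_deriv i \<phi>))" if i: "i \<in> Basis" for i
    using v1[OF i] \<phi>1[OF i] i by (auto intro: continuous_on_subset)
  have cW: "continuous_on UNIV (W i)" and cdW: "continuous_on UNIV (dW i)"
    and int_dW: "integrable lborel (dW i)" if i: "i \<in> Basis" for i
    unfolding W_def dW_def
    by (intro cont_ext int_ext continuous_intros cont i; simp add: K(3) p\<phi>0 pp\<phi>0)+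
  have deriv_W: "((\<lambda>t. W i (x + t *\<^sub>R i)) has_real_derivative dW i x) (at 0)" if i: "i \<in> Basis" for i x
  proof (cases "x \<in> S")
    case True
    have "((\<lambda>t. v (x + t *\<^sub>R i) * partial_deriv i \<phi> (x + t *\<^sub>R i) - \<phi> (x + t *\<^sub>R i) * partial_deriv i v (x + t *\<^sub>R i))
      has_real_derivative dW i x) (at 0)"
      using DERIV_diff[OF DERIV_mult[OF line[OF v2 True i] line[OF \<phi>1[OF i] UNIV_I[of x] i]]
          DERIV_mult[OF line[OF \<phi>2 UNIV_I[of x] i] line[OF v1[OF i] True i]]] True
      by (simp add: dW_def algebra_simps)
    then show ?thesis
      by (subst line_derivative_cong[OF S True, of "W i" "\<lambda>x. v x * partial_deriv i \<phi> x - \<phi> x * partial_deriv i v x"])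
         (auto simp: W_def)
  next
    case False
    then have "x \<in> - K" using K(2) by auto
    then show ?thesis
      using line_derivative_cong[of "- K" x "W i" "\<lambda>_. 0" i "dW i x"] W0 dW0 closed by auto
  qed
  have zero: "integral\<^sup>L lborel (dW i) = 0" if i: "i \<in> Basis" for i
    by (rule integral_line_derivative_eq_0[OF cW[OF i] cdW[OF i] deriv_W[OF i] K(1) W0])
  have "(\<integral>x. indicator S x * (v x * laplacian \<phi> x) \<partial>lborel)
      - (\<integral>x. indicator S x * (\<phi> x * laplacian v x) \<partial>lborel)
      = (\<integral>x. indicator S x * (v x * laplacian \<phi> x) - indicator S x * (\<phi> x * laplacian v x) \<partial>lborel)"
    using continuous_laplacian[OF v] continuous_laplacian[OF \<phi>] laplacian_eq_0_outside[OF closed K(3)]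
    by (intro Bochner_Integration.integral_diff[symmetric] int_ext continuous_intros cont)
       (auto intro: continuous_on_subset simp: K(3))
  also have "\<dots> = (\<integral>x. (\<Sum>i\<in>Basis. dW i x) \<partial>lborel)"
    by (simp add: dW_def laplacian_def sum_distrib_left right_diff_distrib sum_subtractf)
  also have "\<dots> = 0" by (simp add: int_dW zero)
  finally show ?thesis by simp
qed

section \<open>Integrability of the singularity\<close>

text \<open>In the plane, \<open>1 / (s * (- ln s) powr (3/2))\<close> with \<open>s = norm x ^ 2\<close> is integrable at the origin.
  The function is dominated by a series of indicator functions of the balls of radius
  \<open>exp (- k / 2)\<close>, where the \<open>k\<close>-th one takes care of \<open>k \<le> - ln s < k + 1\<close>. In dimension two the
  volumes \<open>exp (- k)\<close> cancel the growth of \<open>1 / s\<close>, so that the series \<open>\<Sum>k. k powr (- 3/2)\<close> remains.\<close>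

lemma integrable_log_singularity:
  assumes dim: "DIM('a::euclidean_space) = 2"
  shows "integrable lborel (\<lambda>x::'a. indicator (ball 0 (exp (-1/2))) x * (1 / ((x \<bullet> x) * sqrt (- ln (x \<bullet> x)) ^ 3)))"
    (is "integrable _ ?F")
proof (rule integrableI_bounded)
  show "?F \<in> borel_measurable lborel"
    unfolding measurable_lborel1 by (intro borel_measurable_times borel_measurable_indicator
      borel_measurable_divide borel_measurable_power borel_measurable_sqrt borel_measurable_uminus borel_measurable_ln
      borel_measurable_inner measurable_ident_sets) auto
  define a where "a k = exp (real k + 1) * real k powr (-3/2)" for k
  define b where "b k = exp (- real k / 2)" for k
  have bsq: "(b k)\<^sup>2 = exp (- real k)" for k
    by (simp add: b_def flip: exp_double)
  have "ennreal (norm (?F x)) \<le> (\<Sum>k. ennreal (a k) * indicator (cball 0 (b k)) x)" for x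
  proof (cases "x \<noteq> 0 \<and> norm x < exp (-1/2)")
    case True
    define s where "s = x \<bullet> x"
    have s: "0 < s" using True by (simp add: s_def)
    have s_norm: "s = (norm x)\<^sup>2" by (simp add: s_def power2_norm_eq_inner)
    have "s < (exp (-1/2))\<^sup>2" unfolding s_norm using True by (intro power_strict_mono) auto
    then have "s < exp (-1)" by (simp flip: exp_double)
    then have L1: "- ln s > 1" using s ln_less_cancel_iff[of s "exp (-1)"] by simp
    define k where "k = nat \<lfloor>- ln s\<rfloor>"
    have k: "real k \<le> - ln s" "- ln s < real k + 1" "k \<ge> 1"
      using L1 unfolding k_def by linarith+
    have "1 / s = exp (- ln s)" using s by (simp add: exp_minus field_simps)
    also have "\<dots> \<le> exp (real k + 1)" using k by simp
    finally have s_inv: "1 / s \<le> exp (real k + 1)" .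
    have "sqrt (- ln s) ^ 3 = (- ln s) powr (3/2)"
      using L1 by (simp add: powr_half_sqrt[symmetric] powr_powr flip: powr_realpow)
    then have "1 / sqrt (- ln s) ^ 3 = (- ln s) powr (-3/2)"
      using powr_minus_divide[of "- ln s" "3/2"] by simp
    also have "\<dots> \<le> real k powr (-3/2)"
      using k by (intro powr_mono2') auto
    finally have L_inv: "1 / sqrt (- ln s) ^ 3 \<le> real k powr (-3/2)" .
    have "sqrt (- ln s) \<ge> 0" using L1 by simp
    then have "norm (?F x) = (1 / s) * (1 / sqrt (- ln s) ^ 3)"
      using True s L1 by (simp add: s_def[symmetric] abs_mult power_abs)
    also have "\<dots> \<le> a k"
      unfolding a_def
    proof (rule mult_mono[OF s_inv L_inv])
      show "0 \<le> 1 / sqrt (- ln s) ^ 3"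
        by (intro divide_nonneg_nonneg zero_le_power \<open>sqrt (- ln s) \<ge> 0\<close> zero_le_one)
    qed simp
    finally have F_le: "norm (?F x) \<le> a k" .
    have "s \<le> exp (- real k)" using k s exp_le_cancel_iff[of "ln s" "- real k"] by simp
    then have "(norm x)\<^sup>2 \<le> (b k)\<^sup>2" by (simp add: bsq s_norm)
    then have "norm x \<le> b k" by (rule power2_le_imp_le) (simp add: b_def)
    then have "ennreal (norm (?F x)) \<le> (\<Sum>j\<in>{k}. ennreal (a j) * indicator (cball 0 (b j)) x)"
      using F_le by (simp add: ennreal_leI)
    also have "\<dots> \<le> (\<Sum>k. ennreal (a k) * indicator (cball 0 (b k)) x)"
      by (rule sum_le_suminf) auto
    finally show ?thesis .
  next
    case False
    then have F0: "?F x = 0" by (auto simp: indicator_def)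
    show ?thesis unfolding F0 by (simp only: norm_zero ennreal_0 zero_le)
  qed
  then have "(\<integral>\<^sup>+x. norm (?F x) \<partial>lborel) \<le> (\<integral>\<^sup>+x. (\<Sum>k. ennreal (a k) * indicator (cball (0::'a) (b k)) x) \<partial>lborel)"
    by (intro nn_integral_mono) auto
  also have "\<dots> = (\<Sum>k. ennreal (a k) * emeasure lborel (cball (0::'a) (b k)))"
    by (subst nn_integral_suminf) (auto simp: nn_integral_cmult_indicator intro!: borel_measurable_times_ennreal borel_measurable_indicator)
  also have "\<dots> = (\<Sum>k. ennreal (unit_ball_vol 2 * exp 1 * real k powr (-3/2)))"
  proof (rule arg_cong[where f = suminf], rule ext)
    fix k
    have "ennreal (a k) * emeasure lborel (cball (0::'a) (b k)) = ennreal (a k * (unit_ball_vol 2 * (b k)\<^sup>2))"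
      using emeasure_cball[of "b k" "0::'a"] dim by (simp add: b_def a_def ennreal_mult')
    also have "a k * (unit_ball_vol 2 * (b k)\<^sup>2) = unit_ball_vol 2 * exp 1 * real k powr (-3/2)"
      unfolding bsq a_def by (simp add: exp_add exp_minus field_simps)
    finally show "ennreal (a k) * emeasure lborel (cball (0::'a) (b k)) = ennreal (unit_ball_vol 2 * exp 1 * real k powr (-3/2))" .
  qed
  also have "\<dots> < \<infinity>"
  proof -
    have "summable (\<lambda>k. unit_ball_vol 2 * exp 1 * real k powr (-3/2))"
      using summable_real_powr_iff[of "-3/2"] by (intro summable_mult) simp
    then show ?thesis
      by (subst suminf_ennreal2) auto
  qed
  finally show "(\<integral>\<^sup>+x. norm (?F x) \<partial>lborel) < \<infinity>" .
qed

section \<open>Approximation of distributional solutions\<close>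

text \<open>A removable singularity criterion. Both sides of Green's identity for \<open>v n\<close> converge
  by dominated convergence; the exceptional point \<open>a\<close> is a null set.\<close>

lemma distributional_solution_by_approximation:
  fixes u :: "'a::euclidean_space \<Rightarrow> real" and v :: "nat \<Rightarrow> 'a \<Rightarrow> real"
  assumes S: "open S"
    and int: "locally_integrable_on u S" "locally_integrable_on (\<lambda>x. f (u x)) S"
    and v: "\<And>n. Ck_on 2 (v n) S"
    and v_lim: "\<And>x. x \<in> S - {a} \<Longrightarrow> (\<lambda>n. v n x) \<longlonglongrightarrow> u x"
    and lap_lim: "\<And>x. x \<in> S - {a} \<Longrightarrow> (\<lambda>n. laplacian (v n) x) \<longlonglongrightarrow> - f (u x)"
    and v_bound: "\<And>n x. x \<in> S - {a} \<Longrightarrow> \<bar>v n x\<bar> \<le> \<bar>u x\<bar>"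
    and lap_bound: "\<And>n x. x \<in> S - {a} \<Longrightarrow> \<bar>laplacian (v n) x\<bar> \<le> A * \<bar>f (u x)\<bar> + B"
  shows "distributional_solution_on f S u"
  unfolding distributional_solution_on_def
proof (intro conjI int allI impI)
  fix \<phi> :: "'a \<Rightarrow> real" assume "test_function_on S \<phi>"
  define K where "K = closure {x. \<phi> x \<noteq> 0}"
  have K: "compact K" "K \<subseteq> S" and \<phi>: "Ck_on 2 \<phi> UNIV"
    using \<open>test_function_on S \<phi>\<close> by (auto simp: test_function_on_def K_def)
  have \<phi>0: "\<phi> x = 0" if "x \<notin> K" for x
    using that closure_subset[of "{x. \<phi> x \<noteq> 0}"] by (auto simp: K_def)
  note closed = compact_imp_closed[OF K(1)]
  have lap0: "laplacian \<phi> x = 0" if "x \<notin> K" for x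
    by (rule laplacian_eq_0_outside[OF closed \<phi>0 that])
  have c\<phi>: "continuous_on T \<phi>" and clap: "continuous_on T (laplacian \<phi>)" for T
    using \<phi> continuous_laplacian[OF \<phi>] by (auto simp: numeral_2_eq_2 intro: continuous_on_subset)
  have cv: "continuous_on S (v n)" and clv: "continuous_on S (laplacian (v n))" for n
    using v[of n] continuous_laplacian[OF v] by (auto simp: numeral_2_eq_2)
  have bounded_K: "\<exists>C. \<forall>x. \<bar>h x\<bar> \<le> C" if "continuous_on UNIV h" "\<And>x. x \<notin> K \<Longrightarrow> h x = 0" for h :: "'a \<Rightarrow> real"
  proof -
    have "compact (h ` K)" using that K(1) by (intro compact_continuous_image) (auto intro: continuous_on_subset)
    then obtain C where "\<And>x. x \<in> K \<Longrightarrow> \<bar>h x\<bar> \<le> C"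
      using compact_imp_bounded by (fastforce simp: bounded_iff)
    then have "\<bar>h x\<bar> \<le> max C 0" for x using that(2)[of x] by (cases "x \<in> K") (auto simp: le_max_iff_disj)
    then show ?thesis by blast
  qed
  obtain C D where C: "\<And>x. \<bar>\<phi> x\<bar> \<le> C" and D: "\<And>x. \<bar>laplacian \<phi> x\<bar> \<le> D"
    using bounded_K[OF c\<phi> \<phi>0] bounded_K[OF clap lap0] by blast
  have borel[measurable]: "\<phi> \<in> borel_measurable lebesgue" "laplacian \<phi> \<in> borel_measurable lebesgue"
    using c\<phi> clap by (auto intro!: measurable_completion borel_measurable_continuous_onI simp: measurable_lborel1)
  have iu: "integrable lebesgue (\<lambda>x. indicator K x *\<^sub>R u x)"
    and ifu: "integrable lebesgue (\<lambda>x. indicator K x *\<^sub>R f (u x))"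
    using int K by (auto simp: locally_integrable_on_def set_integrable_def)
  have iK: "integrable lebesgue (\<lambda>x. indicator K x *\<^sub>R (1::real))"
    using borel_integrable_compact[OF K(1) continuous_on_const[of K "1::real"]]
    by (subst integrable_completion) (auto dest: borel_measurable_integrable)
  have ext: "(\<lambda>x. indicator S x * h x) \<in> borel_measurable borel"
    if "continuous_on S h" "\<And>x. x \<notin> K \<Longrightarrow> h x = 0" for h :: "'a \<Rightarrow> real"
    by (rule borel_measurable_continuous_onI[OF continuous_on_extend_by_zero[OF S closed K(2) that]])
  have off_a: "AE x in lebesgue. x \<noteq> a"
    by (rule AE_completion) (rule AE_lborel_singleton)
  have lim1: "(\<lambda>n. \<integral>x. indicator S x * (v n x * laplacian \<phi> x) \<partial>lebesgue)
      \<longlonglongrightarrow> (\<integral>x. indicator S x * (u x * laplacian \<phi> x) \<partial>lebesgue)"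
  proof (rule integral_dominated_convergence)
    have "(\<lambda>x. indicator S x * (u x * laplacian \<phi> x)) = (\<lambda>x. indicator K x *\<^sub>R u x * laplacian \<phi> x)"
      using lap0 K(2) by (auto simp: fun_eq_iff indicator_def)
    also have "\<dots> \<in> borel_measurable lebesgue"
      using iu by measurable
    finally show "(\<lambda>x. indicator S x * (u x * laplacian \<phi> x)) \<in> borel_measurable lebesgue" .
    show "(\<lambda>x. indicator S x * (v n x * laplacian \<phi> x)) \<in> borel_measurable lebesgue" for n
      by (intro measurable_completion) (simp add: ext lap0 continuous_on_mult cv clap)
    show "integrable lebesgue (\<lambda>x. norm (indicator K x *\<^sub>R u x) * D)"
      using iu by (intro integrable_mult_left integrable_norm) auto
    show "AE x in lebesgue. (\<lambda>n. indicator S x * (v n x * laplacian \<phi> x)) \<longlonglongrightarrow> indicator S x * (u x * laplacian \<phi> x)"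
      using off_a by eventually_elim (auto intro!: tendsto_intros v_lim simp: indicator_def)
    show "AE x in lebesgue. norm (indicator S x * (v n x * laplacian \<phi> x)) \<le> norm (indicator K x *\<^sub>R u x) * D" for n
      using off_a
    proof eventually_elim
      case (elim x)
      show ?case
      proof (cases "x \<in> K")
        case True
        then have "x \<in> S - {a}" using elim K by auto
        then show ?thesis using True v_bound[of x n] D[of x] by (auto simp: abs_mult intro: mult_mono)
      qed (simp add: lap0)
    qed
  qed
  have lim2: "(\<lambda>n. \<integral>x. indicator S x * (\<phi> x * laplacian (v n) x) \<partial>lebesgue)
      \<longlonglongrightarrow> (\<integral>x. indicator S x * (\<phi> x * - f (u x)) \<partial>lebesgue)"
  proof (rule integral_dominated_convergence)
    have "(\<lambda>x. indicator S x * (\<phi> x * - f (u x))) = (\<lambda>x. \<phi> x * - (indicator K x *\<^sub>R f (u x)))"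
      using \<phi>0 K(2) by (auto simp: fun_eq_iff indicator_def)
    also have "\<dots> \<in> borel_measurable lebesgue"
      using ifu by measurable
    finally show "(\<lambda>x. indicator S x * (\<phi> x * - f (u x))) \<in> borel_measurable lebesgue" .
    show "(\<lambda>x. indicator S x * (\<phi> x * laplacian (v n) x)) \<in> borel_measurable lebesgue" for n
      by (intro measurable_completion) (simp add: ext \<phi>0 continuous_on_mult c\<phi> clv)
    show "integrable lebesgue (\<lambda>x. C * (A * norm (indicator K x *\<^sub>R f (u x)) + B * (indicator K x *\<^sub>R 1)))"
      using ifu iK by (intro integrable_mult_right Bochner_Integration.integrable_add integrable_norm) auto
    show "AE x in lebesgue. (\<lambda>n. indicator S x * (\<phi> x * laplacian (v n) x)) \<longlonglongrightarrow> indicator S x * (\<phi> x * - f (u x))"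
      using off_a
    proof eventually_elim
      case (elim x)
      then show ?case
        using tendsto_mult[OF tendsto_const[of "\<phi> x"] lap_lim[of x]] by (cases "x \<in> S") auto
    qed
    show "AE x in lebesgue. norm (indicator S x * (\<phi> x * laplacian (v n) x))
        \<le> C * (A * norm (indicator K x *\<^sub>R f (u x)) + B * (indicator K x *\<^sub>R 1))" for n
      using off_a
    proof eventually_elim
      case (elim x)
      show ?case
      proof (cases "x \<in> K")
        case True
        then have "x \<in> S - {a}" using elim K by auto
        then show ?thesis using True lap_bound[of x n] C[of x] by (auto simp: abs_mult intro: mult_mono)
      qed (simp add: \<phi>0)
    qed
  qed
  have "(\<integral>x. indicator S x * (v n x * laplacian \<phi> x) \<partial>lebesgue)
      = (\<integral>x. indicator S x * (\<phi> x * laplacian (v n) x) \<partial>lebesgue)" for n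
    using green_identity[OF S v \<phi> K \<phi>0]
    by (subst (1 2) integral_completion) (simp_all add: ext lap0 \<phi>0 continuous_on_mult cv clap c\<phi> clv)
  then have "(\<integral>x. indicator S x * (u x * laplacian \<phi> x) \<partial>lebesgue)
      = (\<integral>x. indicator S x * (\<phi> x * - f (u x)) \<partial>lebesgue)"
    using LIMSEQ_unique[OF lim1] lim2 by simp
  then show "- (LINT x:S|lebesgue. u x * laplacian \<phi> x) = (LINT x:S|lebesgue. f (u x) * \<phi> x)"
    by (simp add: set_lebesgue_integral_def mult.commute)
qed

section \<open>A concave truncation\<close>

text \<open>The truncation: \<open>trunc z\<close> agrees with \<open>z\<close> to first order at \<open>0\<close>, is constant for \<open>z \<ge> 1\<close>, and is
  twice continuously differentiable, \<open>trunc'\<close> and \<open>trunc''\<close> being its derivatives.\<close>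

definition trunc :: "real \<Rightarrow> real" where "trunc z = (1 - max 0 (1 - z) ^ 3) / 3"
definition trunc' :: "real \<Rightarrow> real" where "trunc' z = max 0 (1 - z) ^ 2"
definition trunc'' :: "real \<Rightarrow> real" where "trunc'' z = - 2 * max 0 (1 - z)"

lemma DERIV_max_0_power:
  "((\<lambda>x::real. max 0 x ^ Suc (Suc n)) has_real_derivative real (Suc (Suc n)) * max 0 x ^ Suc n) (at x)"
proof -
  have "((\<lambda>x. if x \<le> 0 then 0 else x ^ Suc (Suc n)) has_real_derivative real (Suc (Suc n)) * max 0 x ^ Suc n) (at x)"
  proof (rule has_real_derivative_glue[where a = "- 1 - \<bar>x\<bar>" and b = "1 + \<bar>x\<bar>"])
    show "((\<lambda>x. x ^ Suc (Suc n)) has_real_derivative real (Suc (Suc n)) * max 0 x ^ Suc n) (at x within {0..1 + \<bar>x\<bar>})"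
      if "0 \<le> x"
      using that DERIV_subset[OF DERIV_pow[of "Suc (Suc n)" x UNIV], of "{0..1 + \<bar>x\<bar>}"] by (simp add: max_def)
  qed auto
  also have "(\<lambda>x. if x \<le> 0 then 0 else x ^ Suc (Suc n)) = (\<lambda>x::real. max 0 x ^ Suc (Suc n))"
    by (auto simp: max_def fun_eq_iff)
  finally show ?thesis .
qed

lemma DERIV_trunc: "(trunc has_real_derivative trunc' z) (at z)"
  and DERIV_trunc': "(trunc' has_real_derivative trunc'' z) (at z)"
proof -
  have inner: "((\<lambda>z. 1 - z) has_real_derivative - 1) (at z)" for z :: real
    by (auto intro!: derivative_eq_intros)
  have p: "((\<lambda>z. max 0 (1 - z) ^ Suc (Suc n)) has_real_derivative real (Suc (Suc n)) * max 0 (1 - z) ^ Suc n * - 1) (at z)" for n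
    by (rule DERIV_chain2[OF DERIV_max_0_power inner])
  show "(trunc has_real_derivative trunc' z) (at z)"
    unfolding trunc_def[abs_def] trunc'_def
    using DERIV_cdivide[OF DERIV_diff[OF DERIV_const[of 1] p[of 1]], of 3]
    by (simp add: numeral_2_eq_2 numeral_3_eq_3)
  show "(trunc' has_real_derivative trunc'' z) (at z)"
    unfolding trunc'_def[abs_def] trunc''_def using p[of 0] by (simp add: numeral_2_eq_2)
qed

lemma trunc_ge_1: "z \<ge> 1 \<Longrightarrow> trunc z = 1 / 3" "z \<ge> 1 \<Longrightarrow> trunc' z = 0" "z \<ge> 1 \<Longrightarrow> trunc'' z = 0"
  by (simp_all add: trunc_def trunc'_def trunc''_def)

text \<open>The last bound is the essential one: for \<open>z = u / N\<close> it controls the error term of the truncation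
  by a multiple of the nonlinearity that does not depend on \<open>N\<close>.\<close>

lemma trunc_bounds:
  assumes "z \<ge> 0"
  shows "0 \<le> trunc z" "trunc z \<le> z" "0 \<le> trunc' z" "trunc' z \<le> 1" "\<bar>trunc'' z\<bar> \<le> 2" "\<bar>z * trunc'' z\<bar> \<le> 1/2"
proof -
  define w where "w = max 0 (1 - z)"
  have w: "0 \<le> w" "w \<le> 1" "1 - w \<le> z" using assms by (auto simp: w_def)
  have "w ^ 3 \<le> 1" using w by (simp add: power_le_one)
  then show "0 \<le> trunc z" by (simp add: trunc_def w_def)
  have "1 + real 3 * (w - 1) \<le> (1 + (w - 1)) ^ 3" by (rule Bernoulli_inequality) (use w in simp)
  then show "trunc z \<le> z" using w by (simp add: trunc_def w_def[symmetric])
  show "0 \<le> trunc' z" "trunc' z \<le> 1" using w by (simp_all add: trunc'_def w_def[symmetric] power_le_one)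
  show "\<bar>trunc'' z\<bar> \<le> 2" using w by (simp add: trunc''_def w_def[symmetric])
  have "z * w \<le> 1 / 4"
  proof (cases "z \<le> 1")
    case True
    have "0 \<le> (z - 1 / 2)\<^sup>2" by simp
    then show ?thesis using True by (simp add: w_def power2_eq_square algebra_simps)
  qed (simp add: w_def)
  then show "\<bar>z * trunc'' z\<bar> \<le> 1/2" using w assms by (simp add: trunc''_def w_def[symmetric] abs_mult)
qed

lemma trunc_limits:
  shows "(\<lambda>n. real (Suc n) * trunc (y / real (Suc n))) \<longlonglongrightarrow> y"
    and "(\<lambda>n. trunc' (y / real (Suc n))) \<longlonglongrightarrow> 1"
    and "(\<lambda>n. trunc'' (y / real (Suc n)) / real (Suc n)) \<longlonglongrightarrow> 0"
proof -
  have inv: "(\<lambda>n. 1 / real (Suc n)) \<longlonglongrightarrow> 0" by (rule LIMSEQ_Suc[OF lim_1_over_n])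
  have z: "(\<lambda>n. y / real (Suc n)) \<longlonglongrightarrow> 0" using tendsto_mult_right[OF inv, of y] by simp
  have c: "isCont trunc' 0" "isCont trunc'' 0"
    unfolding trunc'_def[abs_def] trunc''_def[abs_def] by (intro continuous_intros)+
  show "(\<lambda>n. trunc' (y / real (Suc n))) \<longlonglongrightarrow> 1"
    using isCont_tendsto_compose[OF c(1) z] by (simp add: trunc'_def)
  show "(\<lambda>n. trunc'' (y / real (Suc n)) / real (Suc n)) \<longlonglongrightarrow> 0"
    using tendsto_mult[OF isCont_tendsto_compose[OF c(2) z] inv] by simp
  show "(\<lambda>n. real (Suc n) * trunc (y / real (Suc n))) \<longlonglongrightarrow> y"
  proof (cases "y = 0")
    case True
    then show ?thesis by (simp add: trunc_def)
  next
    case False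
    have "((\<lambda>h. (trunc (0 + h) - trunc 0) / h) \<longlongrightarrow> trunc' 0) (at 0)"
      using DERIV_trunc[of 0] by (simp add: DERIV_def)
    moreover have "filterlim (\<lambda>n. y / real (Suc n)) (at 0) sequentially"
      using z False by (simp add: filterlim_at)
    ultimately have "(\<lambda>n. (trunc (0 + y / real (Suc n)) - trunc 0) / (y / real (Suc n))) \<longlonglongrightarrow> trunc' 0"
      by (rule filterlim_compose)
    from tendsto_mult_left[OF this, of y] False show ?thesis
      by (simp add: trunc_def[of 0] trunc'_def mult_ac)
  qed
qed

section \<open>Truncating the singular solution\<close>

lemma locally_integrable_on_dominated:
  fixes h F :: "'a::euclidean_space \<Rightarrow> real"
  assumes cont: "continuous_on (S - {a}) h" and F: "integrable lborel F"
    and bound: "\<And>x. x \<in> S - {a} \<Longrightarrow> \<bar>h x\<bar> \<le> F x + C"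
  shows "locally_integrable_on h S"
  unfolding locally_integrable_on_def set_integrable_def
proof (intro allI impI)
  fix K :: "'a set" assume K: "compact K \<and> K \<subseteq> S"
  have Kb: "K \<in> sets borel" using K by (auto intro: compact_imp_closed borel_closed)
  have "(\<lambda>x. indicator (K - {a}) x *\<^sub>R h x) \<in> borel_measurable borel"
    using K Kb by (intro borel_measurable_continuous_on_indicator) (auto intro: continuous_on_subset[OF cont])
  moreover have "(\<lambda>x. indicator (K \<inter> {a}) x *\<^sub>R h a) \<in> borel_measurable borel"
    using Kb by (intro borel_measurable_scaleR borel_measurable_indicator) auto
  ultimately have "(\<lambda>x. indicator (K - {a}) x *\<^sub>R h x + indicator (K \<inter> {a}) x *\<^sub>R h a) \<in> borel_measurable borel"
    by (rule borel_measurable_add)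
  also have "(\<lambda>x. indicator (K - {a}) x *\<^sub>R h x + indicator (K \<inter> {a}) x *\<^sub>R h a) = (\<lambda>x. indicator K x *\<^sub>R h x)"
    by (auto simp: fun_eq_iff indicator_def)
  finally have meas: "(\<lambda>x. indicator K x *\<^sub>R h x) \<in> borel_measurable borel" .
  have "integrable lborel (\<lambda>x. indicator K x *\<^sub>R h x)"
  proof (rule Bochner_Integration.integrable_bound)
    show "integrable lborel (\<lambda>x. F x + indicator K x *\<^sub>R C)"
      using K by (intro Bochner_Integration.integrable_add F borel_integrable_compact) auto
    show "(\<lambda>x. indicator K x *\<^sub>R h x) \<in> borel_measurable lborel" using meas by simp
    show "AE x in lborel. norm (indicator K x *\<^sub>R h x) \<le> norm (F x + indicator K x *\<^sub>R C)"
      using AE_lborel_singleton[of a]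
    proof eventually_elim
      case (elim x)
      then show ?case using bound[of x] K by (cases "x \<in> K") auto
    qed
  qed
  then show "integrable lebesgue (\<lambda>x. indicator K x *\<^sub>R h x)"
    using meas by (subst integrable_completion) auto
qed

context singular_profile
begin

lemma s0_pos: "0 < s0"
  using s0 exp_gt_zero[of "-5/2"] by linarith

lemma g_ge_beta: "0 < s \<Longrightarrow> s \<le> exp (-5/2) \<Longrightarrow> beta \<le> g s"
  using singular_profile_derivs(4)[of s] g_inner[of s] by simp

lemma g_pos: "0 < s \<Longrightarrow> s < s0 \<Longrightarrow> 0 < g s"
  using g_outer[of s] g_ge_beta[of s] beta_pos by (cases "s \<le> exp (-5/2)") auto

lemma nonlinearity_inner: "0 < s \<Longrightarrow> s \<le> exp (-5/2) \<Longrightarrow> nonlinearity (g s) = 1 / (s * sqrt (- ln s) ^ 3)"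
  using singular_profile_derivs(3)[of s] g_inner[of s] by simp

lemma nonlinearity_outer: "exp (-5/2) \<le> s \<Longrightarrow> s < s0 \<Longrightarrow> nonlinearity (g s) \<le> alpha * beta\<^sup>2"
  using g_outer[of s] alpha_pos by (auto simp: nonlinearity_small intro!: mult_left_mono power_mono)

text \<open>This is the identity \<open>\<bar>\<nabla>u\<bar>\<^sup>2 = u f(u)\<close> for the singular solution, since the squared gradient of
  \<open>g (x \<bullet> x)\<close> is \<open>4 * s * (p s / s)\<^sup>2\<close> at \<open>s = x \<bullet> x\<close>.\<close>

lemma flux_inner:
  assumes "0 < s" "s \<le> exp (-5/2)"
  shows "4 * ((p s)\<^sup>2 / s) = g s * nonlinearity (g s)"
proof -
  have "g s > 0" using g_ge_beta[OF assms] beta_pos by linarith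
  have p: "p s = - 1 / (2 * g s)" using g_inner p_inner assms by simp
  have f: "nonlinearity (g s) = 1 / (s * g s ^ 3)" using nonlinearity_inner g_inner assms by simp
  show ?thesis unfolding p f using assms \<open>g s > 0\<close> by (simp add: field_simps power2_eq_square power3_eq_cube)
qed

text \<open>The constant \<open>8\<close> is that of the error term of the truncation, \<open>4 * \<bar>trunc'' z\<bar> \<le> 8\<close>.\<close>

lemma flux_bounded:
  obtains B where "B \<ge> 0" "\<And>s. exp (-5/2) \<le> s \<Longrightarrow> s < s0 \<Longrightarrow> 8 * ((p s)\<^sup>2 / s) \<le> B"
proof -
  have "continuous_on {exp (-5/2)..s0} (\<lambda>s. 8 * ((p s)\<^sup>2 / s))"
  proof (intro continuous_intros p_cont ballI)
    fix s assume "s \<in> {exp (-5/2)..s0}"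
    then show "s \<noteq> 0" using exp_gt_zero[of "-5/2"] by auto
  qed
  then have "compact ((\<lambda>s. 8 * ((p s)\<^sup>2 / s)) ` {exp (-5/2)..s0})"
    by (intro compact_continuous_image compact_Icc)
  then obtain B where B: "\<And>s. s \<in> {exp (-5/2)..s0} \<Longrightarrow> \<bar>8 * ((p s)\<^sup>2 / s)\<bar> \<le> B"
    using compact_imp_bounded by (fastforce simp: bounded_iff)
  show thesis
  proof
    show "0 \<le> max B 0" by simp
    show "8 * ((p s)\<^sup>2 / s) \<le> max B 0" if "exp (-5/2) \<le> s" "s < s0" for s
      using abs_le_D1[OF B[of s]] that by (simp add: le_max_iff_disj)
  qed
qed

text \<open>The second derivative of \<open>g\<close>, obtained from \<open>g' = p / s\<close> and the equation for \<open>p'\<close>.\<close>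

definition g2 :: "real \<Rightarrow> real" where
  "g2 s = - nonlinearity (g s) / (4 * s) - p s / s\<^sup>2"

lemma g2_deriv:
  assumes "0 < s" "s < s0"
  shows "((\<lambda>s. p s / s) has_real_derivative g2 s) (at s)"
  using assms unfolding g2_def
  by (auto intro!: derivative_eq_intros p_deriv simp: field_simps power2_eq_square)

lemma profile_continuous: "continuous_on {0<..<s0} g" "continuous_on {0<..<s0} (\<lambda>s. p s / s)"
    "continuous_on {0<..<s0} g2"
proof -
  show g: "continuous_on {0<..<s0} g" by (rule continuous_on_subset[OF g_cont]) auto
  show "continuous_on {0<..<s0} (\<lambda>s. p s / s)"
    by (rule DERIV_continuous_on, rule DERIV_subset[OF g2_deriv]) auto
  have p: "continuous_on {0<..<s0} p"
    by (rule DERIV_continuous_on, rule DERIV_subset[OF p_deriv]) auto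
  show "continuous_on {0<..<s0} g2"
    unfolding g2_def using g
    by (intro continuous_intros continuous_on_compose2[OF continuous_nonlinearity[of UNIV] g] p) auto
qed

text \<open>The truncated profile is constant once \<open>g s \<ge> N\<close>, that is for \<open>s \<le> exp (- N\<^sup>2)\<close>, so its extension
  by \<open>N / 3\<close> to all \<open>s \<le> 0\<close> is twice continuously differentiable and yields a \<open>C\<^sup>2\<close> function on the
  full ball. The Laplacian is that of a composition with \<open>trunc\<close>.\<close>

lemma truncated_solution:
  fixes N :: real
  assumes N: "N \<ge> 1" and dim: "DIM('a::euclidean_space) = 2"
  obtains v :: "'a::euclidean_space \<Rightarrow> real" where "Ck_on 2 v {x. x \<bullet> x < s0}"
    and "\<And>x. 0 < x \<bullet> x \<Longrightarrow> x \<bullet> x < s0 \<Longrightarrow> v x = N * trunc (g (x \<bullet> x) / N)"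
    and "\<And>x. 0 < x \<bullet> x \<Longrightarrow> x \<bullet> x < s0 \<Longrightarrow> laplacian v x =
       - trunc' (g (x \<bullet> x) / N) * nonlinearity (g (x \<bullet> x))
       + 4 * (trunc'' (g (x \<bullet> x) / N) / N) * ((p (x \<bullet> x))\<^sup>2 / (x \<bullet> x))"
proof -
  define G where "G s = (if s \<le> 0 then N / 3 else N * trunc (g s / N))" for s
  define G1 where "G1 s = (if s \<le> 0 then 0 else trunc' (g s / N) * (p s / s))" for s
  define G2 where "G2 s = (if s \<le> 0 then 0
      else trunc'' (g s / N) / N * (p s / s)\<^sup>2 + trunc' (g s / N) * g2 s)" for s
  \<comment> \<open>on \<open>s < \<delta>\<close> the explicit formula for \<open>g\<close> is valid and \<open>g s \<ge> N\<close>\<close>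
  define \<delta> where "\<delta> = min (exp (-5/2)) (exp (- (N\<^sup>2)))"
  have \<delta>: "0 < \<delta>" "\<delta> < s0" using s0 by (auto simp: \<delta>_def)
  have small: "G s = N / 3 \<and> G1 s = 0 \<and> G2 s = 0" if "s < \<delta>" for s
  proof (cases "s \<le> 0")
    case False
    then have s: "0 < s" "s \<le> exp (-5/2)" "s \<le> exp (- (N\<^sup>2))" using that by (auto simp: \<delta>_def)
    have "ln s \<le> - (N\<^sup>2)" using s by (metis ln_exp ln_le_cancel_iff exp_gt_zero)
    then have "N \<le> sqrt (- ln s)" by (intro real_le_rsqrt) simp
    then have "g s / N \<ge> 1" using g_inner s N by simp
    then show ?thesis using False by (simp add: G_def G1_def G2_def trunc_ge_1)
  qed (simp add: G_def G1_def G2_def)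
  have d1: "((\<lambda>s. N * trunc (g s / N)) has_real_derivative trunc' (g s / N) * (p s / s)) (at s)"
    and d2: "((\<lambda>s. trunc' (g s / N) * (p s / s)) has_real_derivative
          trunc'' (g s / N) / N * (p s / s)\<^sup>2 + trunc' (g s / N) * g2 s) (at s)"
    if "0 < s" "s < s0" for s
  proof -
    have gN: "((\<lambda>s. g s / N) has_real_derivative (p s / s) / N) (at s)"
      using g_deriv[OF that] by (rule DERIV_cdivide)
    show "((\<lambda>s. N * trunc (g s / N)) has_real_derivative trunc' (g s / N) * (p s / s)) (at s)"
      using DERIV_cmult[OF DERIV_chain2[OF DERIV_trunc gN], of N] N by simp
    show "((\<lambda>s. trunc' (g s / N) * (p s / s)) has_real_derivative
          trunc'' (g s / N) / N * (p s / s)\<^sup>2 + trunc' (g s / N) * g2 s) (at s)"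
      using DERIV_mult[OF DERIV_chain2[OF DERIV_trunc' gN] g2_deriv[OF that]]
      by (simp add: power2_eq_square mult_ac)
  qed
  have D1: "(G has_real_derivative G1 s) (at s)" and D2: "(G1 has_real_derivative G2 s) (at s)"
    if "s \<in> {..<s0}" for s
  proof -
    have "(G has_real_derivative G1 s) (at s) \<and> (G1 has_real_derivative G2 s) (at s)"
    proof (cases "s < \<delta>")
      case True
      have "(G has_real_derivative 0) (at s)"
        by (rule has_field_derivative_transform_within_open[where S = "{..<\<delta>}" and f = "\<lambda>_. N / 3"])
           (use small True in auto)
      moreover have "(G1 has_real_derivative 0) (at s)"
        by (rule has_field_derivative_transform_within_open[where S = "{..<\<delta>}" and f = "\<lambda>_. 0"])
           (use small True in auto)
      ultimately show ?thesis using small[OF True] by simp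
    next
      case False
      then have s: "0 < s" "s < s0" using \<delta> that by auto
      have "((\<lambda>s. N * trunc (g s / N)) has_real_derivative G1 s) (at s)"
        "((\<lambda>s. trunc' (g s / N) * (p s / s)) has_real_derivative G2 s) (at s)"
        using d1[OF s] d2[OF s] s by (simp_all add: G1_def G2_def)
      then show ?thesis
        using s has_field_derivative_transform_within_open[of "\<lambda>s. N * trunc (g s / N)" _ s "{0<..}" G]
          has_field_derivative_transform_within_open[of "\<lambda>s. trunc' (g s / N) * (p s / s)" _ s "{0<..}" G1]
        by (auto simp: G_def G1_def)
    qed
    then show "(G has_real_derivative G1 s) (at s)" "(G1 has_real_derivative G2 s) (at s)" by auto
  qed
  have "continuous_on {0<..<s0} (\<lambda>s. trunc'' (g s / N) / N * (p s / s)\<^sup>2 + trunc' (g s / N) * g2 s)"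
    unfolding trunc'_def trunc''_def using N
    by (intro continuous_intros profile_continuous) auto
  then have "continuous_on {0<..<s0} G2"
    by (rule continuous_on_eq) (auto simp: G2_def)
  moreover have "continuous_on {..<\<delta>} G2"
    by (rule continuous_on_eq[OF continuous_on_const[of _ 0]]) (use small in auto)
  moreover have "{..<s0} = {..<\<delta>} \<union> {0<..<s0}" using \<delta> by auto
  ultimately have C2: "continuous_on {..<s0} G2"
    by (metis continuous_on_open_Un open_lessThan open_greaterThanLessThan)
  have lap: "4 * s * G2 s + 4 * G1 s = - trunc' (g s / N) * nonlinearity (g s)
       + 4 * (trunc'' (g s / N) / N) * ((p s)\<^sup>2 / s)" if "0 < s" for s
    using that N by (simp add: G1_def G2_def g2_def field_simps power2_eq_square)
  show thesis
  proof (rule that[of "\<lambda>x. G (x \<bullet> x)"])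
    show "Ck_on 2 (\<lambda>x::'a. G (x \<bullet> x)) {x. x \<bullet> x < s0}"
      using Ck_on_2_radial[OF open_lessThan D1 D2 C2] by simp
    fix x :: 'a assume x: "0 < x \<bullet> x" "x \<bullet> x < s0"
    have pos: "\<not> x \<bullet> x \<le> 0" using x(1) by linarith
    show "G (x \<bullet> x) = N * trunc (g (x \<bullet> x) / N)" by (simp only: G_def pos if_False)
    have "laplacian (\<lambda>x::'a. G (x \<bullet> x)) x = 4 * (x \<bullet> x) * G2 (x \<bullet> x) + 4 * G1 (x \<bullet> x)"
      using laplacian_radial[OF open_lessThan D1 D2 C2, of x] x dim by simp
    also have "\<dots> = - trunc' (g (x \<bullet> x) / N) * nonlinearity (g (x \<bullet> x))
       + 4 * (trunc'' (g (x \<bullet> x) / N) / N) * ((p (x \<bullet> x))\<^sup>2 / (x \<bullet> x))"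
      by (rule lap[OF x(1)])
    finally show "laplacian (\<lambda>x::'a. G (x \<bullet> x)) x = - trunc' (g (x \<bullet> x) / N) * nonlinearity (g (x \<bullet> x))
       + 4 * (trunc'' (g (x \<bullet> x) / N) / N) * ((p (x \<bullet> x))\<^sup>2 / (x \<bullet> x))" .
  qed
qed

end

section \<open>The solution on the ball\<close>

context singular_profile
begin

text \<open>For \<open>s \<le> exp (-5/2)\<close> the nonlinearity equals the logarithmic singularity, and it is bounded
  elsewhere. The solution itself is dominated by its nonlinearity, because
  \<open>exp (y\<^sup>2) \<ge> y ^ 4 / 2\<close> gives \<open>y \<le> 2 * nonlinearity y\<close> above \<open>beta\<close>.\<close>

lemma locally_integrable_solution:
  assumes dim: "DIM('a::euclidean_space) = 2"
  shows "locally_integrable_on (\<lambda>x::'a. nonlinearity (g (x \<bullet> x))) {x. x \<bullet> x < s0}"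
    and "locally_integrable_on (\<lambda>x::'a. g (x \<bullet> x)) {x. x \<bullet> x < s0}"
proof -
  define F :: "'a \<Rightarrow> real" where
    "F x = indicator (ball 0 (exp (-1/2))) x * (1 / ((x \<bullet> x) * sqrt (- ln (x \<bullet> x)) ^ 3))" for x
  define C where "C = alpha * beta\<^sup>2"
  have C: "C \<ge> 0" using alpha_pos by (simp add: C_def)
  have F: "integrable lborel F" unfolding F_def by (rule integrable_log_singularity[OF dim])
  have pos: "0 < x \<bullet> x \<and> x \<bullet> x < s0" if "x \<in> {x. x \<bullet> x < s0} - {0}" for x :: 'a
    using that by simp
  have bound: "\<bar>nonlinearity (g (x \<bullet> x))\<bar> \<le> F x + C" if "x \<in> {x. x \<bullet> x < s0} - {0}" for x
  proof (cases "x \<bullet> x \<le> exp (-5/2)")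
    case True
    have "norm x < exp (-1/2)"
    proof (rule power2_less_imp_less)
      have "(norm x)\<^sup>2 \<le> exp (-5/2)" using True by (simp add: power2_norm_eq_inner)
      also have "\<dots> < (exp (-1/2))\<^sup>2" by (simp flip: exp_double)
      finally show "(norm x)\<^sup>2 < (exp (-1/2))\<^sup>2" .
    qed simp
    then have "nonlinearity (g (x \<bullet> x)) = F x"
      using nonlinearity_inner[of "x \<bullet> x"] pos[OF that] True by (simp add: F_def)
    then show ?thesis using C nonlinearity_nonneg[of "g (x \<bullet> x)"] by simp
  next
    case False
    have "F x \<ge> 0"
    proof (cases "x \<in> ball 0 (exp (-1/2))")
      case True
      then have "(norm x)\<^sup>2 < (exp (-1/2))\<^sup>2" by (intro power_strict_mono) auto
      then have "x \<bullet> x < exp (-1)" by (simp add: power2_norm_eq_inner flip: exp_double)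
      then have "ln (x \<bullet> x) < ln (exp (-1))" using pos[OF that] by (subst ln_less_cancel_iff) auto
      then show ?thesis by (simp add: F_def)
    qed (simp add: F_def)
    then show ?thesis
      using nonlinearity_outer[of "x \<bullet> x"] pos[OF that] False nonlinearity_nonneg[of "g (x \<bullet> x)"]
      by (simp add: C_def)
  qed
  have cont: "continuous_on ({x. x \<bullet> x < s0} - {0}) (\<lambda>x::'a. g (x \<bullet> x))"
    by (rule continuous_on_compose2[OF profile_continuous(1)]) (use pos in \<open>auto intro!: continuous_intros\<close>)
  show "locally_integrable_on (\<lambda>x::'a. nonlinearity (g (x \<bullet> x))) {x. x \<bullet> x < s0}"
    by (rule locally_integrable_on_dominated[OF continuous_on_compose2[OF continuous_nonlinearity cont] F bound]) auto
  show "locally_integrable_on (\<lambda>x::'a. g (x \<bullet> x)) {x. x \<bullet> x < s0}"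
  proof (rule locally_integrable_on_dominated[OF cont])
    show "integrable lborel (\<lambda>x. 2 * F x)" using F by simp
    fix x :: 'a assume x: "x \<in> {x. x \<bullet> x < s0} - {0}"
    define y where "y = g (x \<bullet> x)"
    have y: "y > 0" using g_pos pos[OF x] by (simp add: y_def)
    have "y \<le> 2 * nonlinearity y + beta"
    proof (cases "y \<le> beta")
      case True
      then show ?thesis using nonlinearity_nonneg[of y] by simp
    next
      case False
      have "(y\<^sup>2)\<^sup>2 / 2 \<le> exp (y\<^sup>2)"
        using exp_lower_Taylor_quadratic[OF zero_le_power2[of y]] zero_le_power2[of y] by linarith
      then have "y / 2 \<le> exp (y\<^sup>2) / y ^ 3" using y by (simp add: field_simps eval_nat_numeral)
      also have "\<dots> = nonlinearity y" using False nonlinearity_large[of y] by simp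
      finally show ?thesis using beta_pos by linarith
    qed
    then show "\<bar>g (x \<bullet> x)\<bar> \<le> 2 * F x + (2 * C + beta)"
      using bound[OF x] y unfolding y_def[symmetric] by linarith
  qed
qed

text \<open>Near the origin \<open>flux_inner\<close> turns the error term of the truncation into
  \<open>z * trunc'' z * nonlinearity y\<close>, which \<open>trunc_bounds\<close> controls; away from the origin the
  gradient is bounded.\<close>

lemma distributional_solution:
  assumes dim: "DIM('a::euclidean_space) = 2"
  shows "distributional_solution_on nonlinearity {x. x \<bullet> x < s0} (\<lambda>x::'a. g (x \<bullet> x))"
proof -
  let ?S = "{x::'a. x \<bullet> x < s0}"
  define P where "P N v \<longleftrightarrow> Ck_on 2 v ?S \<and> (\<forall>x\<in>?S - {0}. v x = N * trunc (g (x \<bullet> x) / N) \<and>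
      laplacian v x = - trunc' (g (x \<bullet> x) / N) * nonlinearity (g (x \<bullet> x))
       + 4 * (trunc'' (g (x \<bullet> x) / N) / N) * ((p (x \<bullet> x))\<^sup>2 / (x \<bullet> x)))" for N v
  have "\<exists>v. P (real (Suc n)) v" for n
    using truncated_solution[of "real (Suc n)", OF _ dim] unfolding P_def
    by (metis (mono_tags, lifting) DiffE inner_gt_zero_iff insertCI mem_Collect_eq of_nat_1 of_nat_le_iff One_nat_def Suc_le_mono zero_le)
  then obtain v where v: "\<And>n. P (real (Suc n)) (v n)" by metis
  obtain B where B: "B \<ge> 0" "\<And>s. exp (-5/2) \<le> s \<Longrightarrow> s < s0 \<Longrightarrow> 8 * ((p s)\<^sup>2 / s) \<le> B"
    using flux_bounded by blast
  have "open ?S"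
    using open_vimage[of "{..<s0}" "\<lambda>x::'a. x \<bullet> x"] by (simp add: vimage_def continuous_intros)
  then show ?thesis
  proof (rule distributional_solution_by_approximation[where a = 0 and v = v and A = 2 and B = B])
    show "Ck_on 2 (v n) ?S" for n using v[of n] by (simp add: P_def)
    fix x :: 'a assume x: "x \<in> ?S - {0}"
    define s where "s = x \<bullet> x"
    have s: "0 < s" "s < s0" using x by (simp_all add: s_def)
    define y where "y = g s"
    have y: "y > 0" using g_pos[OF s] by (simp add: y_def)
    have vx: "v n x = real (Suc n) * trunc (y / real (Suc n))"
      and lx: "laplacian (v n) x = - trunc' (y / real (Suc n)) * nonlinearity y
       + 4 * (trunc'' (y / real (Suc n)) / real (Suc n)) * ((p s)\<^sup>2 / s)" for n
      using v[of n] x by (auto simp: P_def s_def y_def)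
    have "(\<lambda>n. v n x) \<longlonglongrightarrow> y" unfolding vx by (rule trunc_limits)
    then show "(\<lambda>n. v n x) \<longlonglongrightarrow> g (x \<bullet> x)" by (simp add: y_def s_def)
    have "(\<lambda>n. laplacian (v n) x) \<longlonglongrightarrow> - 1 * nonlinearity y + 4 * 0 * ((p s)\<^sup>2 / s)"
      unfolding lx by (intro tendsto_intros trunc_limits)
    then show "(\<lambda>n. laplacian (v n) x) \<longlonglongrightarrow> - nonlinearity (g (x \<bullet> x))" by (simp add: y_def s_def)
    fix n
    define N where "N = real (Suc n)"
    define z where "z = y / N"
    have N: "N \<ge> 1" and z: "z \<ge> 0" and Nz: "N * z = y" using y by (simp_all add: N_def z_def)
    note tr = trunc_bounds[OF z]
    have "\<bar>N * trunc z\<bar> \<le> y" using mult_left_mono[OF tr(2), of N] tr(1) N Nz by simp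
    then show "\<bar>v n x\<bar> \<le> \<bar>g (x \<bullet> x)\<bar>"
      using y by (simp only: vx N_def[symmetric] z_def[symmetric] s_def[symmetric] y_def[symmetric])
    have first: "\<bar>trunc' z * nonlinearity y\<bar> \<le> nonlinearity y"
      using tr nonlinearity_nonneg[of y] by (simp add: abs_mult mult_left_le_one_le)
    have second: "\<bar>4 * (trunc'' z / N) * ((p s)\<^sup>2 / s)\<bar> \<le> nonlinearity y + B"
    proof (cases "s \<le> exp (-5/2)")
      case True
      have "4 * (trunc'' z / N) * ((p s)\<^sup>2 / s) = (trunc'' z / N) * (4 * ((p s)\<^sup>2 / s))" by simp
      also have "\<dots> = z * trunc'' z * nonlinearity y"
        unfolding flux_inner[OF s(1) True] by (simp add: z_def y_def)
      also have "\<bar>\<dots>\<bar> \<le> 1/2 * nonlinearity y"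
        unfolding abs_mult[of "z * trunc'' z"] using tr nonlinearity_nonneg[of y] by (intro mult_mono) auto
      finally show ?thesis using B(1) nonlinearity_nonneg[of y] by linarith
    next
      case False
      have "\<bar>trunc'' z / N\<bar> \<le> 2" using tr(5) N by (simp add: abs_divide divide_le_eq)
      then have "\<bar>4 * (trunc'' z / N)\<bar> * ((p s)\<^sup>2 / s) \<le> 8 * ((p s)\<^sup>2 / s)"
        using s by (intro mult_right_mono) auto
      then show ?thesis
        using B(2)[of s] s False nonlinearity_nonneg[of y] by (simp add: abs_mult)
    qed
    show "\<bar>laplacian (v n) x\<bar> \<le> 2 * \<bar>nonlinearity (g (x \<bullet> x))\<bar> + B"
      using first second nonlinearity_nonneg[of y]
      unfolding lx N_def[symmetric] z_def[symmetric] s_def[symmetric] y_def[symmetric] by linarith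
  qed (rule locally_integrable_solution[OF dim])+
qed

lemma classical_solution:
  assumes dim: "DIM('a::euclidean_space) = 2"
  shows "Ck_on 2 (\<lambda>x::'a. g (x \<bullet> x)) {x. x \<bullet> x \<in> {0<..<s0}}"
    and "\<And>x::'a. x \<bullet> x \<in> {0<..<s0} \<Longrightarrow> - laplacian (\<lambda>x. g (x \<bullet> x)) x = nonlinearity (g (x \<bullet> x))"
proof -
  have d: "(g has_real_derivative p s / s) (at s)" "((\<lambda>s. p s / s) has_real_derivative g2 s) (at s)"
    if "s \<in> {0<..<s0}" for s
    using that g_deriv g2_deriv by auto
  have ode: "4 * s * g2 s + 4 * (p s / s) = - nonlinearity (g s)" if "0 < s" for s
    using that by (simp add: g2_def field_simps power2_eq_square)
  show "Ck_on 2 (\<lambda>x::'a. g (x \<bullet> x)) {x. x \<bullet> x \<in> {0<..<s0}}"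
    by (rule Ck_on_2_radial[OF open_greaterThanLessThan d profile_continuous(3)])
  fix x :: 'a assume x: "x \<bullet> x \<in> {0<..<s0}"
  show "- laplacian (\<lambda>x. g (x \<bullet> x)) x = nonlinearity (g (x \<bullet> x))"
    using laplacian_radial[OF open_greaterThanLessThan d profile_continuous(3) x]
      ode[of "x \<bullet> x"] x dim by simp
qed

end

theorem proposition2p1:
  shows "\<exists>(\<rho>::real) (u :: real^2 \<Rightarrow> real). \<rho> > 0 \<and>
    Ck_on 2 u (ball 0 \<rho> - {0}) \<and> continuous_on (cball 0 \<rho> - {0}) u \<and>
    (\<forall>x \<in> ball 0 \<rho> - {0}. - laplacian u x = nonlinearity (u x)) \<and>
    (\<forall>x \<in> sphere 0 \<rho>. u x = 0) \<and>
    (\<forall>\<^sub>F x in at 0. u x = sqrt (- 2 * ln (norm x))) \<and>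
    distributional_solution_on nonlinearity (ball 0 \<rho>) u"
proof -
  obtain s0 g p where "singular_profile s0 g p" using singular_profile_exists by blast
  then interpret singular_profile s0 g p .
  define u :: "real^2 \<Rightarrow> real" where "u = (\<lambda>x. g (x \<bullet> x))"
  have dim: "DIM(real^2) = 2" by simp
  have ball: "ball 0 (sqrt s0) = {x :: real^2. x \<bullet> x < s0}"
    and cball: "cball 0 (sqrt s0) = {x :: real^2. x \<bullet> x \<le> s0}"
    by (auto simp: norm_eq_sqrt_inner)
  have punctured: "ball 0 (sqrt s0) - {0} = {x :: real^2. x \<bullet> x \<in> {0<..<s0}}"
    unfolding ball by auto
  have "continuous_on (cball 0 (sqrt s0) - {0}) u"
    unfolding u_def cball
    by (rule continuous_on_compose2[OF g_cont]) (auto intro!: continuous_intros)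
  moreover have "u x = 0" if "x \<in> sphere 0 (sqrt s0)" for x
    using that g_boundary s0_pos by (simp add: u_def norm_eq_sqrt_inner)
  moreover have "\<forall>\<^sub>F x in at 0. u x = sqrt (- 2 * ln (norm x))"
  proof -
    have "u x = sqrt (- 2 * ln (norm x))" if "x \<noteq> 0" "norm x < exp (-5/4)" for x :: "real^2"
    proof -
      have "x \<bullet> x = (norm x)\<^sup>2" by (simp add: power2_norm_eq_inner)
      also have "\<dots> \<le> (exp (-5/4))\<^sup>2" using that by (intro power_mono) auto
      also have "\<dots> = exp (-5/2)" by (simp flip: exp_double)
      finally have "u x = sqrt (- ln (x \<bullet> x))" using g_inner that by (simp add: u_def)
      also have "ln (x \<bullet> x) = 2 * ln (norm x)"
        using that by (simp flip: power2_norm_eq_inner add: ln_realpow)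
      finally show ?thesis by simp
    qed
    then show ?thesis unfolding eventually_at by (intro exI[of _ "exp (-5/4)"]) auto
  qed
  ultimately show ?thesis
    using s0_pos classical_solution[OF dim] distributional_solution[OF dim]
    unfolding u_def punctured[symmetric] ball[symmetric]
    by (intro exI[of _ "sqrt s0"] exI[of _ "\<lambda>x. g (x \<bullet> x)"]) (simp add: punctured)
qed

end
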